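(* For any outerplanar graph $G$ with maximum degree $\Delta(G)\ge 6$, $\mu_{\mathrm{int}}(G)\le \left\lceil \frac{\Delta(G)}{5}\right\rceil$.
   Context: Graphs are finite and simple. An outerplanar graph is a planar graph that has a planar embedding in which all vertices are on the boundary of the outer face. An improper interval coloring of a graph $G$ is an assignment of colors (natural numbers) to the edges of $G$, not necessarily proper, such that for every vertex $v$ the set of colors on the edges incident with $v$ is an integral interval (a set of consecutive integers). It is $k$-improper if at most $k$ edges with the same color all share a common endpoint, i.e. at each vertex each color appears on at most $k$ incident edges. The interval coloring impropriety $\mu_{\mathrm{int}}(G)$ is the smallest positive integer $k$ such that $G$ has a $k$-improper interval coloring. *)

theory Defs
  imports "HOL-Analysis.Analysis"
begin

definition simple_graph :: "'a set \<Rightarrow> 'a set set \<Rightarrow> bool" where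
  "simple_graph V E \<longleftrightarrow> finite V \<and> (\<forall>e\<in>E. e \<subseteq> V \<and> card e = 2)"

definition incident_edges :: "'a set set \<Rightarrow> 'a \<Rightarrow> 'a set set" where
  "incident_edges E v = {e \<in> E. v \<in> e}"

definition vertex_degree :: "'a set set \<Rightarrow> 'a \<Rightarrow> nat" where
  "vertex_degree E v = card (incident_edges E v)"

(* The inserted 0 only gives the graph without vertices a defined maximum degree. *)
definition max_degree :: "'a set \<Rightarrow> 'a set set \<Rightarrow> nat" where
  "max_degree V E = Max (insert 0 (vertex_degree E ` V))"

(* Vertices are points of the Euclidean plane (as the complex plane), edges are arcs, i.e.
   homeomorphic images of the unit interval, which meet each other and the set of vertices
   only in common end vertices. *)
definition plane_embedding ::
  "'a set \<Rightarrow> 'a set set \<Rightarrow> ('a \<Rightarrow> complex) \<Rightarrow> ('a set \<Rightarrow> real \<Rightarrow> complex) \<Rightarrow> bool" where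
  "plane_embedding V E p \<gamma> \<longleftrightarrow>
     inj_on p V \<and>
     (\<forall>e\<in>E. arc (\<gamma> e) \<and> {pathstart (\<gamma> e), pathfinish (\<gamma> e)} = p ` e) \<and>
     (\<forall>e\<in>E. path_image (\<gamma> e) \<inter> p ` V = p ` e) \<and>
     (\<forall>e\<in>E. \<forall>f\<in>E. e \<noteq> f \<longrightarrow> path_image (\<gamma> e) \<inter> path_image (\<gamma> f) = p ` (e \<inter> f))"

definition drawing ::
  "'a set \<Rightarrow> 'a set set \<Rightarrow> ('a \<Rightarrow> complex) \<Rightarrow> ('a set \<Rightarrow> real \<Rightarrow> complex) \<Rightarrow> complex set" where
  "drawing V E p \<gamma> = p ` V \<union> (\<Union>e\<in>E. path_image (\<gamma> e))"

(* The drawing of a finite graph is compact, so its complement has exactly one unbounded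
   component, the outer face; this is the set that the library calls outside. *)
definition outerplanar :: "'a set \<Rightarrow> 'a set set \<Rightarrow> bool" where
  "outerplanar V E \<longleftrightarrow>
     (\<exists>p \<gamma>. plane_embedding V E p \<gamma> \<and> p ` V \<subseteq> frontier (outside (drawing V E p \<gamma>)))"

(* At an isolated vertex the set of colors is empty, which is the case a > b. *)
definition improper_interval_coloring :: "'a set \<Rightarrow> 'a set set \<Rightarrow> ('a set \<Rightarrow> nat) \<Rightarrow> bool" where
  "improper_interval_coloring V E c \<longleftrightarrow> (\<forall>v\<in>V. \<exists>a b. c ` incident_edges E v = {a..b})"

definition k_improper_interval_coloring ::
  "nat \<Rightarrow> 'a set \<Rightarrow> 'a set set \<Rightarrow> ('a set \<Rightarrow> nat) \<Rightarrow> bool" where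
  "k_improper_interval_coloring k V E c \<longleftrightarrow>
     improper_interval_coloring V E c \<and>
     (\<forall>v\<in>V. \<forall>i. card {e \<in> incident_edges E v. c e = i} \<le> k)"

definition mu_int :: "'a set \<Rightarrow> 'a set set \<Rightarrow> nat" where
  "mu_int V E = (LEAST k. k > 0 \<and> (\<exists>c. k_improper_interval_coloring k V E c))"

(* The minimum in mu_int is attained: coloring all edges alike is always allowed. *)
lemma mu_int_exists:
  assumes "simple_graph V E"
  shows "\<exists>k>0. \<exists>c. k_improper_interval_coloring k V E c"
proof -
  have fin: "finite E"
    using assms by (auto simp: simple_graph_def intro: finite_subset[of E "Pow V"])
  have "(\<lambda>_. 0) ` incident_edges E v \<in> {{}, {0::nat}}" for v
    by auto
  moreover have "{} = {1..0::nat}" "{0} = {0..0::nat}" by auto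
  ultimately have "\<exists>a b. (\<lambda>_. 0) ` incident_edges E v = {a..b::nat}" for v
    by (metis empty_iff insert_iff)
  moreover have "card {e \<in> incident_edges E v. (0::nat) = i} \<le> Suc (card E)" for v i
    by (rule le_SucI, rule card_mono[OF fin]) (auto simp: incident_edges_def)
  ultimately have "k_improper_interval_coloring (Suc (card E)) V E (\<lambda>_. 0)"
    unfolding k_improper_interval_coloring_def improper_interval_coloring_def by blast
  then show ?thesis by blast
qed

end

theory Submission imports Defs begin

text \<open>
Every outerplanar graph has a 2-improper interval coloring, and a maximum degree of at least 6
makes the claimed bound at least 2. The proof passes from the plane drawing to a linear order of
the vertices and colors along breadth-first layers.

From topology only two facts are needed. A closed curve formed by edges has no vertex in its
interior, because every vertex is a limit of points of the outer face. In a theta curve, one of the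
three arcs runs inside the closed curve formed by the other two
(\<open>theta_some_arc_inside\<close>, a consequence of Janiszewski's theorem). Hence no two vertices are
joined by three internally disjoint paths that all have inner vertices (\<open>theta_free_edges\<close>), and
no cycle has two crossing chords (\<open>crossing_free_edges\<close>).

A graph with these two properties can be drawn with its vertices on a line and its edges as
noncrossing arcs above the line (\<open>one_page_exists\<close>). If the graph is disconnected
or has a cut vertex, the drawings of two parts are glued. Otherwise a longest cycle is Hamiltonian,
since an ear attached to it would either lengthen it or create a theta, and its cyclic order works.

In a connected one-page drawing take the distance from the leftmost vertex as the level of a vertex.
An edge covers only vertices that are further from the root than one of its ends. Therefore a vertex
has at most one parent on each side and at most one neighbor of its own level on each side,
and its children lie in the two gaps next to it. Let the peak of a vertex be the largest color on
the edges to its parents. An edge inside a level gets the larger of the two peaks. On each side of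
a vertex \<open>v\<close>, the edges to the children get consecutive colors, increasing from the
farthest child to the nearest, beginning just above the color of the edge from \<open>v\<close> to its neighbor on
that side, or above the peak of \<open>v\<close> if there is none. By induction on the level, the peaks of
two vertices that face each other across a gap differ by at most 1 (\<open>gap_near\<close>). It follows
that the colors at a vertex form an interval and that no color repeats on one of its two sides, so
each color occurs at most twice (\<open>two_improper\<close>).
\<close>

section \<open>Paths and cycles as vertex lists\<close>

abbreviation path_in :: "'a set set \<Rightarrow> 'a list \<Rightarrow> bool" where
  "path_in E \<equiv> successively (\<lambda>x y. {x, y} \<in> E)"

definition cycle_in :: "'a set set \<Rightarrow> 'a list \<Rightarrow> bool" where
  "cycle_in E xs \<longleftrightarrow> distinct xs \<and> 2 \<le> length xs \<and> path_in E xs \<and> {last xs, hd xs} \<in> E"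

text \<open>
The forbidden configuration is a subdivision of $K_{2,3}$ in which \<open>a\<close> and \<open>b\<close> form the
smaller side.
\<close>
definition theta_free :: "'a set set \<Rightarrow> bool" where
  "theta_free E \<longleftrightarrow> (\<forall>a b p q r. p \<noteq> [] \<and> q \<noteq> [] \<and> r \<noteq> [] \<and> distinct (a # b # p @ q @ r) \<longrightarrow>
     \<not> (path_in E (a # p @ [b]) \<and> path_in E (a # q @ [b]) \<and> path_in E (a # r @ [b])))"

definition crossing_free :: "'a set set \<Rightarrow> bool" where
  "crossing_free E \<longleftrightarrow> (\<forall>xs i j k l. cycle_in E xs \<and> i < j \<and> j < k \<and> k < l \<and> l < length xs \<longrightarrow>
     \<not> ({xs ! i, xs ! k} \<in> E \<and> {xs ! j, xs ! l} \<in> E))"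

lemma path_in_mono: "path_in F xs \<Longrightarrow> F \<subseteq> E \<Longrightarrow> path_in E xs"
  by (erule successively_mono) auto

lemma theta_free_subset:
  assumes "theta_free E" "F \<subseteq> E"
  shows "theta_free F"
  unfolding theta_free_def
proof (intro allI impI notI, elim conjE)
  fix a b p q r
  assume *: "p \<noteq> []" "q \<noteq> []" "r \<noteq> []" "distinct (a # b # p @ q @ r)"
    and "path_in F (a # p @ [b])" "path_in F (a # q @ [b])" "path_in F (a # r @ [b])"
  note this(5-7)[THEN path_in_mono[OF _ assms(2)]]
  thus False using assms(1) * unfolding theta_free_def by blast
qed

lemma crossing_free_subset:
  assumes "crossing_free E" "F \<subseteq> E"
  shows "crossing_free F"
  unfolding crossing_free_def
proof (intro allI impI notI, elim conjE)
  fix xs i j k l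
  assume *: "cycle_in F xs" "i < j" "j < k" "k < l" "l < length xs"
    and F: "{xs ! i, xs ! k} \<in> F" "{xs ! j, xs ! l} \<in> F"
  have "path_in E xs" using *(1) path_in_mono[OF _ assms(2)] unfolding cycle_in_def by blast
  hence "cycle_in E xs" using *(1) assms(2) unfolding cycle_in_def by blast
  thus False using assms * F unfolding crossing_free_def by blast
qed

lemma path_in_rev: "path_in E xs \<Longrightarrow> path_in E (rev xs)"
  unfolding successively_rev by (simp add: insert_commute)

lemma path_in_join: "path_in E (xs @ [v] @ ys) \<longleftrightarrow> path_in E (xs @ [v]) \<and> path_in E (v # ys)"
  by (auto simp: successively_append_iff)

lemma cycle_in_rotate:
  assumes "cycle_in E (us @ vs)"
  shows "cycle_in E (vs @ us)"
proof (cases "us = [] \<or> vs = []")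
  case False
  thus ?thesis using assms
    by (auto simp: cycle_in_def successively_append_iff)
qed (use assms in auto)

lemma cycle_in_split:
  assumes "cycle_in E xs" "x \<in> set xs" "y \<in> set xs" "x \<noteq> y"
  obtains p q where "cycle_in E (x # p @ y # q)" "set (x # p @ y # q) = set xs"
    "length (x # p @ y # q) = length xs"
proof -
  obtain us vs where xs: "xs = us @ x # vs" using assms(2) by (meson split_list)
  have "y \<in> set (vs @ us)" using assms(3,4) xs by auto
  then obtain p q where pq: "vs @ us = p @ y # q" by (meson split_list)
  have eq: "(x # vs) @ us = x # p @ y # q" using pq by simp
  have "cycle_in E (x # p @ y # q)"
    using cycle_in_rotate[of E us "x # vs"] assms(1) unfolding xs eq by simp
  moreover have "set (x # p @ y # q) = set xs" unfolding eq[symmetric] xs by auto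
  moreover have "length (x # p @ y # q) = length xs" unfolding eq[symmetric] xs by auto
  ultimately show thesis by (rule that)
qed

section \<open>Theta curves in the plane\<close>

text \<open>
The Jordan curve theorem in terms of two arcs with common ends, since each two of the three
arcs of a theta curve form a closed curve.
\<close>
lemma two_arcs_Jordan:
  fixes c1 c2 :: "real \<Rightarrow> complex"
  assumes c: "arc c1" "arc c2" "pathstart c1 = a" "pathfinish c1 = b" "pathstart c2 = a" "pathfinish c2 = b"
    and int: "path_image c1 \<inter> path_image c2 = {a, b}"
  shows "inside (path_image c1 \<union> path_image c2) \<noteq> {}"
    and "connected (inside (path_image c1 \<union> path_image c2))"
    and "connected (outside (path_image c1 \<union> path_image c2))"
    and "frontier (inside (path_image c1 \<union> path_image c2)) = path_image c1 \<union> path_image c2"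
proof -
  let ?c = "c1 +++ reversepath c2"
  have "simple_path ?c"
    by (rule simple_path_join_loop) (use c int in \<open>auto simp: arc_reversepath\<close>)
  moreover have "pathfinish ?c = pathstart ?c" using c by simp
  moreover have "path_image ?c = path_image c1 \<union> path_image c2" using c by (simp add: path_image_join)
  ultimately show "inside (path_image c1 \<union> path_image c2) \<noteq> {}"
      "connected (inside (path_image c1 \<union> path_image c2))"
      "connected (outside (path_image c1 \<union> path_image c2))"
      "frontier (inside (path_image c1 \<union> path_image c2)) = path_image c1 \<union> path_image c2"
    using Jordan_inside_outside[of ?c] by simp_all
qed

lemma connected_subset_component:
  "connected C \<Longrightarrow> C \<subseteq> S \<Longrightarrow> x \<in> C \<Longrightarrow> y \<in> C \<Longrightarrow> connected_component S x y"
  unfolding connected_component_def by (intro exI[of _ C]) simp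

lemma connected_in_inside:
  assumes "connected X" "X \<inter> S = {}" "x \<in> X" "x \<in> inside S"
  shows "X \<subseteq> inside S"
proof
  fix y assume "y \<in> X"
  moreover have "X \<subseteq> - S" using assms(2) by blast
  ultimately have "connected_component (- S) x y"
    using assms(1,3) \<open>y \<in> X\<close> by (intro connected_subset_component[of X]) simp_all
  thus "y \<in> inside S" using inside_same_component assms(4) by blast
qed

lemma arc_interior_inside:
  fixes c :: "real \<Rightarrow> complex"
  assumes "arc c" "pathstart c = a" "pathfinish c = b" "path_image c \<inter> S = {a, b}"
    and "path_image c \<inter> inside S \<noteq> {}"
  shows "path_image c - {a, b} \<subseteq> inside S"
proof -
  obtain x where x: "x \<in> path_image c" "x \<in> inside S" using assms(5) by blast
  have "inside S \<inter> S = {}" by simp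
  hence "x \<notin> S" using x by blast
  hence "x \<in> path_image c - {a, b}" using x assms(4) by blast
  moreover have "connected (path_image c - {a, b})"
    using connected_simple_path_endless[OF arc_imp_simple_path[OF assms(1)]] assms(2,3) by simp
  moreover have "(path_image c - {a, b}) \<inter> S = {}" using assms(4) by blast
  ultimately show ?thesis using x(2) by (intro connected_in_inside[where x = x])
qed

text \<open>
If neither of two arcs enters the region cut off by the other one and \<open>c1\<close>, then each of
the two regions avoids the boundary of the other. If they met, they would coincide, and so would
their boundaries, although only one of these contains the inner points of \<open>c2\<close>.
\<close>
lemma theta_insides_disjoint:
  fixes c1 c2 c3 :: "real \<Rightarrow> complex"
  assumes c1: "arc c1" "pathstart c1 = a" "pathfinish c1 = b"
    and c2: "arc c2" "pathstart c2 = a" "pathfinish c2 = b"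
    and c3: "arc c3" "pathstart c3 = a" "pathfinish c3 = b"
    and int: "path_image c1 \<inter> path_image c2 = {a, b}" "path_image c1 \<inter> path_image c3 = {a, b}"
      "path_image c2 \<inter> path_image c3 = {a, b}"
    and out: "path_image c3 \<inter> inside (path_image c1 \<union> path_image c2) = {}"
      "path_image c2 \<inter> inside (path_image c1 \<union> path_image c3) = {}"
  shows "inside (path_image c1 \<union> path_image c2) \<inter> inside (path_image c1 \<union> path_image c3) = {}"
proof (rule ccontr)
  let ?S = "path_image c1 \<union> path_image c2" and ?T = "path_image c1 \<union> path_image c3"
  assume "inside ?S \<inter> inside ?T \<noteq> {}"
  then obtain x where x: "x \<in> inside ?S" "x \<in> inside ?T" by blast
  have dis: "inside ?S \<inter> ?S = {}" "inside ?T \<inter> ?T = {}" by simp_all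
  note JS = two_arcs_Jordan[OF c1(1) c2(1) c1(2,3) c2(2,3) int(1)]
  note JT = two_arcs_Jordan[OF c1(1) c3(1) c1(2,3) c3(2,3) int(2)]
  have d: "inside ?S \<inter> ?T = {}" "inside ?T \<inter> ?S = {}"
  proof -
    have "I \<inter> (A \<union> C) = {}" if "I \<inter> (A \<union> B) = {}" "C \<inter> I = {}" for I A B C :: "complex set"
      using that by blast
    from this[OF dis(1) out(1)] this[OF dis(2) out(2)]
    show "inside ?S \<inter> ?T = {}" "inside ?T \<inter> ?S = {}" .
  qed
  have "inside ?S = inside ?T"
    by (rule equalityI[OF connected_in_inside[OF JS(2) d(1) x] connected_in_inside[OF JT(2) d(2) x(2,1)]])
  hence "frontier (inside ?S) = frontier (inside ?T)" by (rule arg_cong)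
  hence "?S = ?T" unfolding JS(4) JT(4) .
  moreover have "path_image c2 \<subseteq> ?S" by (rule Un_upper2)
  ultimately have "path_image c2 \<subseteq> path_image c1 \<union> path_image c3" by (rule subst)
  hence "path_image c2 \<subseteq> {a, b}" using int(1,3) by auto
  moreover have "path_image c2 - {a, b} \<noteq> {}"
    using nonempty_simple_path_endless[OF arc_imp_simple_path[OF c2(1)]] c2 by simp
  ultimately show False by blast
qed

text \<open>
Otherwise a point \<open>x\<close> enclosed by \<open>c1\<close> and \<open>c2\<close> lies outside the two other closed curves.
These curves meet exactly in the connected set \<open>path_image c3\<close>, and neither separates \<open>x\<close> from a point far away.
By Janiszewski's theorem their union does not separate them either, but it contains
the curve formed by \<open>c1\<close> and \<open>c2\<close>.
\<close>
lemma theta_some_arc_inside: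
  fixes c1 c2 c3 :: "real \<Rightarrow> complex"
  assumes c1: "arc c1" "pathstart c1 = a" "pathfinish c1 = b"
    and c2: "arc c2" "pathstart c2 = a" "pathfinish c2 = b"
    and c3: "arc c3" "pathstart c3 = a" "pathfinish c3 = b"
    and int: "path_image c1 \<inter> path_image c2 = {a, b}" "path_image c1 \<inter> path_image c3 = {a, b}"
      "path_image c2 \<inter> path_image c3 = {a, b}"
  shows "path_image c1 \<inter> inside (path_image c2 \<union> path_image c3) \<noteq> {} \<or>
    path_image c2 \<inter> inside (path_image c1 \<union> path_image c3) \<noteq> {} \<or>
    path_image c3 \<inter> inside (path_image c1 \<union> path_image c2) \<noteq> {}"
proof (rule ccontr)
  let ?J12 = "path_image c1 \<union> path_image c2" and ?J13 = "path_image c1 \<union> path_image c3"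
    and ?J23 = "path_image c2 \<union> path_image c3"
  let ?J = "?J13 \<union> ?J23"
  assume "\<not> ?thesis"
  hence out: "path_image c1 \<inter> inside ?J23 = {}" "path_image c2 \<inter> inside ?J13 = {}"
    "path_image c3 \<inter> inside ?J12 = {}" by (simp_all only: de_Morgan_disj not_not)
  have compact: "compact (path_image c1)" "compact (path_image c2)" "compact (path_image c3)"
    using c1 c2 c3 by (auto intro: compact_path_image arc_imp_path)
  obtain x where x: "x \<in> inside ?J12"
    using two_arcs_Jordan(1)[OF c1(1) c2(1) c1(2,3) c2(2,3) int(1)] by blast
  have "outside ?J \<noteq> {}"
    using compact by (intro outside_bounded_nonempty) (auto intro: compact_imp_bounded)
  then obtain y where y: "y \<in> outside ?J" by blast
  have yout: "y \<in> outside ?J12" "y \<in> outside ?J13" "y \<in> outside ?J23"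
    using y subsetD[OF outside_mono[of ?J12 ?J]] subsetD[OF outside_mono[of ?J13 ?J]]
      subsetD[OF outside_mono[of ?J23 ?J]] by auto
  have xJ: "x \<notin> path_image c1" "x \<notin> path_image c2" "x \<notin> path_image c3"
    using disjoint_iff[THEN iffD1, OF inside_no_overlap[of ?J12]] disjoint_iff[THEN iffD1, OF out(3)] x by auto
  have "x \<notin> inside ?J13"
    using disjoint_iff[THEN iffD1, OF theta_insides_disjoint[OF c1 c2 c3 int out(3,2)]] x by simp
  moreover have "x \<notin> ?J13" using xJ by simp
  ultimately have x13: "x \<in> outside ?J13" by (simp add: outside_inside)
  have "x \<notin> inside ?J23"
    using disjoint_iff[THEN iffD1, OF theta_insides_disjoint[OF c2 c1 c3 _ int(3,2)]] int(1) out(1,3) x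
    by (simp add: Un_commute Int_commute)
  moreover have "x \<notin> ?J23" using xJ by simp
  ultimately have x23: "x \<in> outside ?J23" by (simp add: outside_inside)
  have "connected_component (- ?J) x y"
  proof (rule Janiszewski)
    show "compact ?J13" "closed ?J23" using compact by (auto intro: compact_imp_closed)
    have "path_image c1 \<inter> path_image c2 \<subseteq> path_image c3" using int by auto
    hence "?J13 \<inter> ?J23 = path_image c3" by auto
    thus "connected (?J13 \<inter> ?J23)" using connected_arc_image[OF c3(1)] by simp
    show "connected_component (- ?J13) x y"
      by (rule connected_subset_component[OF two_arcs_Jordan(3)[OF c1(1) c3(1) c1(2,3) c3(2,3) int(2)] _ x13 yout(2)])
        (auto simp: outside_def)
    show "connected_component (- ?J23) x y"
      by (rule connected_subset_component[OF two_arcs_Jordan(3)[OF c2(1) c3(1) c2(2,3) c3(2,3) int(3)] _ x23 yout(3)])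
        (auto simp: outside_def)
  qed
  hence "connected_component (- ?J12) x y"
    by (rule connected_component_of_subset) auto
  hence "y \<in> inside ?J12" using inside_same_component x by metis
  thus False using yout(1) disjoint_iff[THEN iffD1, OF inside_Int_outside[of ?J12]] by simp
qed

lemma arc_ends_in_closure:
  fixes c :: "real \<Rightarrow> complex"
  assumes "arc c"
  shows "path_image c \<subseteq> closure (path_image c - {pathstart c, pathfinish c})"
proof -
  have "continuous_on {0..1} c" using arc_imp_path[OF assms] by (simp add: path_def)
  hence "c ` closure {0<..<1} \<subseteq> closure (c ` {0<..<1})"
    by (intro image_closure_subset) (auto simp: closure_subset)
  thus ?thesis
    unfolding simple_path_endless[OF arc_imp_simple_path[OF assms]] by (simp add: path_image_def)
qed

section \<open>Theta subgraphs and crossing chords in outerplane drawings\<close>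

fun path_edges :: "'a list \<Rightarrow> 'a set set" where
  "path_edges (x # y # zs) = insert {x, y} (path_edges (y # zs))"
| "path_edges _ = {}"

lemma path_edges_subset: "path_in E xs \<Longrightarrow> path_edges xs \<subseteq> E"
  by (induction xs rule: path_edges.induct) auto

lemma Union_path_edges_subset: "\<Union> (path_edges xs) \<subseteq> set xs"
  by (induction xs rule: path_edges.induct) auto

lemma Union_path_edges: "2 \<le> length xs \<Longrightarrow> \<Union> (path_edges xs) = set xs"
proof (induction xs rule: path_edges.induct)
  case (1 x y zs)
  show ?case using 1 by (cases zs) auto
qed auto

lemma path_edges_append:
  "us \<noteq> [] \<Longrightarrow> vs \<noteq> [] \<Longrightarrow>
     path_edges (us @ vs) = insert {last us, hd vs} (path_edges us \<union> path_edges vs)"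
proof (induction us rule: path_edges.induct)
  case (1 x y zs)
  thus ?case by (auto simp: insert_commute)
next
  case ("2_2" v)
  thus ?case by (cases vs) auto
qed auto

lemma path_edges_rev: "path_edges (rev xs) = path_edges xs"
proof (induction xs rule: path_edges.induct)
  case (1 x y zs)
  have "path_edges (rev (y # zs) @ [x]) = insert {last (rev (y # zs)), x} (path_edges (rev (y # zs)))"
    using path_edges_append[of "rev (y # zs)" "[x]"] by simp
  also have "\<dots> = path_edges (x # y # zs)" unfolding 1 by (simp add: insert_commute)
  finally show ?case by simp
qed auto

text \<open>
A common edge would have to be the edge \<open>{a, b}\<close>, which is not an edge of a longer path
from \<open>a\<close> to \<open>b\<close>.
\<close>
lemma path_edges_disjoint:
  assumes "distinct (a # b # P @ Q)" "P \<noteq> [] \<or> Q \<noteq> []" "\<forall>e\<in>path_edges (a # P @ [b]). card e = 2"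
  shows "path_edges (a # P @ [b]) \<inter> path_edges (a # Q @ [b]) = {}"
proof -
  have not_chord: "{a, b} \<notin> path_edges (a # R @ [b])" if "R \<noteq> []" "distinct (a # b # R)" for R
  proof -
    from that(1) obtain r R' where R: "R = r # R'" by (cases R) auto
    have "{a, b} \<notin> path_edges (R @ [b])"
    proof
      assume "{a, b} \<in> path_edges (R @ [b])"
      hence "{a, b} \<subseteq> set (R @ [b])" using Union_path_edges_subset[of "R @ [b]"] by (rule subset_trans[OF Union_upper])
      thus False using that(2) by simp
    qed
    moreover have "{a, b} \<noteq> {a, r}" using that(2) R by (auto simp: doubleton_eq_iff)
    ultimately show ?thesis unfolding R by simp
  qed
  have False if e: "e \<in> path_edges (a # P @ [b])" "e \<in> path_edges (a # Q @ [b])" for e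
  proof -
    have "e \<subseteq> set (a # P @ [b])" "e \<subseteq> set (a # Q @ [b])"
      by (rule subset_trans[OF Union_upper[OF e(1)] Union_path_edges_subset],
          rule subset_trans[OF Union_upper[OF e(2)] Union_path_edges_subset])
    hence "e \<subseteq> {a, b}" using assms(1) by auto
    moreover have "card e = 2" using assms(3) e(1) by simp
    moreover have "card {a, b} = 2" using assms(1) by simp
    ultimately have ab: "e = {a, b}" by (intro card_subset_eq) simp_all
    have "distinct (a # b # P)" "distinct (a # b # Q)" using assms(1) by auto
    thus False using e not_chord[of P] not_chord[of Q] assms(2) unfolding ab by metis
  qed
  thus ?thesis by (intro equals0I) auto
qed

locale outerplane =
  fixes V :: "'a set" and E :: "'a set set" and p :: "'a \<Rightarrow> complex" and \<gamma> :: "'a set \<Rightarrow> real \<Rightarrow> complex"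
  assumes simple: "simple_graph V E"
    and embedding: "plane_embedding V E p \<gamma>"
    and outer: "p ` V \<subseteq> frontier (outside (drawing V E p \<gamma>))"
begin

definition drawn :: "'a set set \<Rightarrow> complex set" where
  "drawn F = (\<Union>e\<in>F. path_image (\<gamma> e))"

lemma inj_p: "inj_on p V"
  using embedding by (simp add: plane_embedding_def)

lemma gamma: "e \<in> E \<Longrightarrow> arc (\<gamma> e)" "e \<in> E \<Longrightarrow> {pathstart (\<gamma> e), pathfinish (\<gamma> e)} = p ` e"
  using embedding by (simp_all add: plane_embedding_def)

lemma gamma_V: "e \<in> E \<Longrightarrow> path_image (\<gamma> e) \<inter> p ` V = p ` e"
  using embedding by (simp add: plane_embedding_def)

lemma gamma_Int: "e \<in> E \<Longrightarrow> f \<in> E \<Longrightarrow> e \<noteq> f \<Longrightarrow> path_image (\<gamma> e) \<inter> path_image (\<gamma> f) = p ` (e \<inter> f)"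
  using embedding by (simp add: plane_embedding_def)

lemma edge_in: "{x, y} \<in> E \<Longrightarrow> x \<in> V \<and> y \<in> V \<and> x \<noteq> y"
  using simple by (fastforce simp: simple_graph_def)

lemma edge_card: "e \<in> E \<Longrightarrow> e \<subseteq> V" "e \<in> E \<Longrightarrow> card e = 2"
  using simple by (simp_all add: simple_graph_def)

lemma drawn_Int:
  assumes "F \<subseteq> E" "G \<subseteq> E" "F \<inter> G = {}"
  shows "drawn F \<inter> drawn G \<subseteq> p ` (\<Union>F \<inter> \<Union>G)"
proof
  fix z assume "z \<in> drawn F \<inter> drawn G"
  then obtain e f where ef: "e \<in> F" "f \<in> G" and z: "z \<in> path_image (\<gamma> e) \<inter> path_image (\<gamma> f)"
    by (auto simp: drawn_def)
  have "e \<in> E" "f \<in> E" "e \<noteq> f" using ef assms by auto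
  from z[unfolded gamma_Int[OF this]] show "z \<in> p ` (\<Union>F \<inter> \<Union>G)" using ef by auto
qed

lemma vertex_in_drawn_iff:
  assumes "F \<subseteq> E" "v \<in> V"
  shows "p v \<in> drawn F \<longleftrightarrow> v \<in> \<Union>F"
proof -
  have "p v \<in> path_image (\<gamma> e) \<longleftrightarrow> v \<in> e" if "e \<in> F" for e
  proof -
    have e: "e \<in> E" "e \<subseteq> V" using that assms(1) edge_card(1) by auto
    have "p v \<in> path_image (\<gamma> e) \<longleftrightarrow> p v \<in> path_image (\<gamma> e) \<inter> p ` V" using assms(2) by simp
    also have "\<dots> \<longleftrightarrow> p v \<in> p ` e" unfolding gamma_V[OF e(1)] ..
    also have "\<dots> \<longleftrightarrow> v \<in> e" by (rule inj_on_image_mem_iff[OF inj_p assms(2) e(2)])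
    finally show ?thesis .
  qed
  thus ?thesis by (auto simp: drawn_def)
qed

lemma drawn_subset_drawing: "F \<subseteq> E \<Longrightarrow> drawn F \<subseteq> drawing V E p \<gamma>"
  unfolding drawn_def drawing_def by blast

lemma finite_E: "finite E"
  by (rule finite_subset[of _ "Pow V"]) (use simple in \<open>auto simp: simple_graph_def\<close>)

lemma closed_drawn: "F \<subseteq> E \<Longrightarrow> closed (drawn F)"
  unfolding drawn_def using finite_subset[OF _ finite_E] gamma(1)
  by (intro closed_UN ballI) (auto intro!: closed_path_image arc_imp_path)

text \<open>
This is where outerplanarity enters: points of the outer face come arbitrarily close to
\<open>p v\<close>, and the outer face lies outside every closed curve that is part of the drawing.
\<close>
lemma vertex_not_inside:
  assumes "F \<subseteq> E" "v \<in> V"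
  shows "p v \<notin> inside (drawn F)"
proof
  assume i: "p v \<in> inside (drawn F)"
  have "p v \<in> closure (outside (drawing V E p \<gamma>))" using outer assms(2) by (auto simp: frontier_def)
  moreover have "open (inside (drawn F))" by (rule open_inside[OF closed_drawn[OF assms(1)]])
  ultimately have "inside (drawn F) \<inter> outside (drawing V E p \<gamma>) \<noteq> {}"
    using i open_Int_closure_eq_empty by blast
  moreover have "outside (drawing V E p \<gamma>) \<subseteq> outside (drawn F)"
    by (rule outside_mono[OF drawn_subset_drawing[OF assms(1)]])
  ultimately have "inside (drawn F) \<inter> outside (drawn F) \<noteq> {}" by fast
  thus False by simp
qed

lemma edge_arc:
  assumes "{x, y} \<in> E"
  shows "\<exists>g. arc g \<and> pathstart g = p x \<and> pathfinish g = p y \<and> path_image g = path_image (\<gamma> {x, y})"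
proof -
  have "{pathstart (\<gamma> {x, y}), pathfinish (\<gamma> {x, y})} = {p x, p y}" using gamma(2)[OF assms] by simp
  then consider "pathstart (\<gamma> {x, y}) = p x" "pathfinish (\<gamma> {x, y}) = p y"
    | "pathstart (\<gamma> {x, y}) = p y" "pathfinish (\<gamma> {x, y}) = p x"
    by (auto simp: doubleton_eq_iff)
  thus ?thesis
  proof cases
    case 1 thus ?thesis using gamma(1)[OF assms] by blast
  next
    case 2 thus ?thesis using gamma(1)[OF assms]
      by (intro exI[of _ "reversepath (\<gamma> {x, y})"]) (simp add: arc_reversepath)
  qed
qed

lemma path_arc:
  assumes "path_in E xs" "distinct xs" "2 \<le> length xs"
  shows "\<exists>g. arc g \<and> pathstart g = p (hd xs) \<and> pathfinish g = p (last xs) \<and> path_image g = drawn (path_edges xs)"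
  using assms
proof (induction xs rule: path_edges.induct)
  case (1 x y zs)
  have xy: "{x, y} \<in> E" using 1(2) by simp
  obtain g where g: "arc g" "pathstart g = p x" "pathfinish g = p y" "path_image g = path_image (\<gamma> {x, y})"
    using edge_arc[OF xy] by blast
  show ?case
  proof (cases "zs = []")
    case True
    thus ?thesis using g by (auto simp: drawn_def)
  next
    case False
    have zs: "path_in E (y # zs)" "distinct (y # zs)" "2 \<le> length (y # zs)"
      using 1(2,3) False by (cases zs; simp)+
    obtain h where h: "arc h" "pathstart h = p y" "pathfinish h = p (last (y # zs))"
      "path_image h = drawn (path_edges (y # zs))" using 1(1)[OF zs] by auto
    have "\<Union> (path_edges (y # zs)) \<subseteq> set (y # zs)" by (rule Union_path_edges_subset)
    hence x: "x \<notin> \<Union> (path_edges (y # zs))" using 1(3) by auto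
    hence "{{x, y}} \<inter> path_edges (y # zs) = {}" by blast
    hence "drawn {{x, y}} \<inter> drawn (path_edges (y # zs)) \<subseteq> p ` (\<Union>{{x, y}} \<inter> \<Union> (path_edges (y # zs)))"
      using xy path_edges_subset[OF zs(1)] by (intro drawn_Int) auto
    also have "\<dots> \<subseteq> {p y}" using x by auto
    finally have "path_image g \<inter> path_image h \<subseteq> {pathstart h}" using g h by (simp add: drawn_def)
    hence "arc (g +++ h)" using g h by (intro arc_join) auto
    moreover have "path_image (g +++ h) = drawn (path_edges (x # y # zs))"
      using g h by (simp add: path_image_join drawn_def)
    ultimately show ?thesis using g h by (intro exI[of _ "g +++ h"]) simp
  qed
qed auto

lemma paths_meet:
  assumes "distinct (a # b # P @ Q)" "P \<noteq> [] \<or> Q \<noteq> []" "path_in E (a # P @ [b])" "path_in E (a # Q @ [b])"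
  shows "drawn (path_edges (a # P @ [b])) \<inter> drawn (path_edges (a # Q @ [b])) = {p a, p b}"
proof
  let ?F = "path_edges (a # P @ [b])" and ?G = "path_edges (a # Q @ [b])"
  have F: "?F \<subseteq> E" and G: "?G \<subseteq> E" by (rule path_edges_subset[OF assms(3)], rule path_edges_subset[OF assms(4)])
  have U: "\<Union> ?F = set (a # P @ [b])" "\<Union> ?G = set (a # Q @ [b])" by (rule Union_path_edges; simp)+
  have "?F \<inter> ?G = {}" by (rule path_edges_disjoint[OF assms(1,2)]) (use F edge_card(2) in auto)
  hence "drawn ?F \<inter> drawn ?G \<subseteq> p ` (\<Union> ?F \<inter> \<Union> ?G)" by (rule drawn_Int[OF F G])
  also have "\<dots> \<subseteq> {p a, p b}" unfolding U using assms(1) by auto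
  finally show "drawn ?F \<inter> drawn ?G \<subseteq> {p a, p b}" .
  have ab: "a \<in> \<Union> ?F" "b \<in> \<Union> ?F" "a \<in> \<Union> ?G" "b \<in> \<Union> ?G" unfolding U by auto
  have "\<Union> ?F \<subseteq> V" using F edge_card(1) by (intro Union_least) auto
  hence "a \<in> V" "b \<in> V" using ab by auto
  thus "{p a, p b} \<subseteq> drawn ?F \<inter> drawn ?G"
    using ab vertex_in_drawn_iff[OF F] vertex_in_drawn_iff[OF G] by simp
qed

text \<open>
A path that entered the interior would stay there except for its ends, and would carry its
inner vertex with it.
\<close>
lemma path_with_vertex_not_inside:
  assumes "distinct (a # b # P)" "P \<noteq> []" "path_in E (a # P @ [b])" "G \<subseteq> E"
    and "drawn (path_edges (a # P @ [b])) \<inter> drawn G = {p a, p b}"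
  shows "drawn (path_edges (a # P @ [b])) \<inter> inside (drawn G) = {}"
proof (rule ccontr)
  let ?F = "path_edges (a # P @ [b])"
  assume ne: "drawn ?F \<inter> inside (drawn G) \<noteq> {}"
  have F: "?F \<subseteq> E" using assms(3) by (rule path_edges_subset)
  have U: "\<Union> ?F = set (a # P @ [b])" by (rule Union_path_edges) simp
  have V: "set (a # P @ [b]) \<subseteq> V" unfolding U[symmetric] using F edge_card(1) by (intro Union_least) auto
  obtain g where g: "arc g" "pathstart g = p a" "pathfinish g = p b" "path_image g = drawn ?F"
    using path_arc[OF assms(3)] assms(1) by auto
  obtain v where v: "v \<in> set P" using assms(2) by (cases P) auto
  have "p v \<in> drawn ?F" using vertex_in_drawn_iff[OF F, of v] U V v by auto
  moreover have "p v \<noteq> p a" "p v \<noteq> p b" using inj_p V v assms(1) by (auto simp: inj_on_def)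
  moreover have "path_image g - {p a, p b} \<subseteq> inside (drawn G)"
    by (rule arc_interior_inside[OF g(1-3)]) (unfold g(4), rule assms(5), rule ne)
  ultimately have "p v \<in> inside (drawn G)" using g(4) by auto
  thus False using vertex_not_inside[OF assms(4), of v] V v by auto
qed

lemma drawn_Un: "drawn (F \<union> G) = drawn F \<union> drawn G"
  unfolding drawn_def by blast

text \<open>
The first two paths have inner vertices, so by \<open>path_with_vertex_not_inside\<close> the third one is the arc
that lies inside. It may be a single edge; then this says that chords of a cycle are drawn inside.
\<close>
lemma theta_last_inside:
  assumes d: "distinct (a # b # P @ Q @ R)" and ne: "P \<noteq> []" "Q \<noteq> []"
    and P: "path_in E (a # P @ [b])" and Q: "path_in E (a # Q @ [b])" and R: "path_in E (a # R @ [b])"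
  shows "drawn (path_edges (a # R @ [b])) \<inter> inside (drawn (path_edges (a # P @ [b])) \<union> drawn (path_edges (a # Q @ [b]))) \<noteq> {}"
proof -
  let ?F = "path_edges (a # P @ [b])" and ?G = "path_edges (a # Q @ [b])" and ?H = "path_edges (a # R @ [b])"
  have E: "?F \<subseteq> E" "?G \<subseteq> E" "?H \<subseteq> E"
    by (rule path_edges_subset[OF P], rule path_edges_subset[OF Q], rule path_edges_subset[OF R])
  have PQ: "drawn ?F \<inter> drawn ?G = {p a, p b}" by (rule paths_meet) (use d ne P Q in auto)
  have PR: "drawn ?F \<inter> drawn ?H = {p a, p b}" by (rule paths_meet) (use d ne P R in auto)
  have QR: "drawn ?G \<inter> drawn ?H = {p a, p b}" by (rule paths_meet) (use d ne Q R in auto)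
  obtain f where f: "arc f" "pathstart f = p a" "pathfinish f = p b" "path_image f = drawn ?F"
    using path_arc[OF P] d by (auto simp: last_append)
  obtain g where g: "arc g" "pathstart g = p a" "pathfinish g = p b" "path_image g = drawn ?G"
    using path_arc[OF Q] d by auto
  obtain h where h: "arc h" "pathstart h = p a" "pathfinish h = p b" "path_image h = drawn ?H"
    using path_arc[OF R] d by auto
  have "drawn ?F \<inter> drawn (?G \<union> ?H) = {p a, p b}" unfolding drawn_Un Int_Un_distrib PQ PR by simp
  hence "drawn ?F \<inter> inside (drawn (?G \<union> ?H)) = {}"
    by (intro path_with_vertex_not_inside) (use d ne P E in simp_all)
  moreover have "drawn ?G \<inter> drawn (?F \<union> ?H) = {p a, p b}"
    unfolding drawn_Un Int_Un_distrib Int_commute[of "drawn ?G" "drawn ?F"] PQ QR by simp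
  hence "drawn ?G \<inter> inside (drawn (?F \<union> ?H)) = {}"
    by (intro path_with_vertex_not_inside) (use d ne Q E in simp_all)
  ultimately show ?thesis
    using theta_some_arc_inside[OF f(1-3) g(1-3) h(1-3), unfolded f(4) g(4) h(4), OF PQ PR QR]
    by (simp only: drawn_Un) simp
qed

lemma theta_free_edges: "theta_free E"
  unfolding theta_free_def
proof (intro allI impI notI, elim conjE)
  fix a b P Q R
  assume ne: "P \<noteq> []" "Q \<noteq> []" "R \<noteq> []" and d: "distinct (a # b # P @ Q @ R)"
    and P: "path_in E (a # P @ [b])" and Q: "path_in E (a # Q @ [b])" and R: "path_in E (a # R @ [b])"
  let ?F = "path_edges (a # P @ [b])" and ?G = "path_edges (a # Q @ [b])" and ?H = "path_edges (a # R @ [b])"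
  have E: "?F \<subseteq> E" "?G \<subseteq> E" "?H \<subseteq> E"
    by (rule path_edges_subset[OF P], rule path_edges_subset[OF Q], rule path_edges_subset[OF R])
  have PR: "drawn ?H \<inter> drawn ?F = {p a, p b}" by (rule paths_meet) (use d ne P R in auto)
  have QR: "drawn ?H \<inter> drawn ?G = {p a, p b}" by (rule paths_meet) (use d ne Q R in auto)
  have "drawn ?H \<inter> drawn (?F \<union> ?G) = {p a, p b}" unfolding drawn_Un Int_Un_distrib PR QR by simp
  hence "drawn ?H \<inter> inside (drawn (?F \<union> ?G)) = {}"
    by (intro path_with_vertex_not_inside) (use d ne R E in simp_all)
  thus False using theta_last_inside[OF d ne(1,2) P Q R] by (simp add: drawn_Un)
qed

definition cycle_edges :: "'b list \<Rightarrow> 'b set set" where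
  "cycle_edges xs = insert {last xs, hd xs} (path_edges xs)"

lemma cycle_edges_rotate: "us \<noteq> [] \<Longrightarrow> vs \<noteq> [] \<Longrightarrow> cycle_edges (us @ vs) = cycle_edges (vs @ us)"
  unfolding cycle_edges_def by (auto simp: path_edges_append)

lemma cycle_arcs:
  assumes "cycle_in E (x # P @ y # Q)"
  shows "path_in E (x # P @ [y])" "path_in E (x # rev Q @ [y])" "distinct (x # y # P @ rev Q)"
    "path_edges (x # P @ [y]) \<union> path_edges (x # rev Q @ [y]) = cycle_edges (x # P @ y # Q)"
proof -
  have path: "path_in E ((x # P) @ [y] @ Q)" and close: "{last (y # Q), x} \<in> E"
    using assms by (simp_all add: cycle_in_def)
  show "path_in E (x # P @ [y])" using path unfolding path_in_join by simp
  have "path_in E ((y # Q) @ [x])"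
    using path close unfolding path_in_join successively_append_iff[of _ "y # Q" "[x]"] by simp
  from path_in_rev[OF this] show "path_in E (x # rev Q @ [y])" by simp
  show "distinct (x # y # P @ rev Q)" using assms by (auto simp: cycle_in_def)
  have "path_edges (x # rev Q @ [y]) = path_edges ((y # Q) @ [x])"
    using path_edges_rev[of "(y # Q) @ [x]"] by simp
  also have "\<dots> = insert {last (y # Q), x} (path_edges (y # Q))"
    using path_edges_append[of "y # Q" "[x]"] by simp
  finally have 1: "path_edges (x # rev Q @ [y]) = insert {last (y # Q), x} (path_edges (y # Q))" .
  have 2: "path_edges (x # P @ [y]) = insert {last (x # P), y} (path_edges (x # P))"
    using path_edges_append[of "x # P" "[y]"] by simp
  have 3: "path_edges (x # P @ y # Q) = insert {last (x # P), y} (path_edges (x # P) \<union> path_edges (y # Q))"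
    using path_edges_append[of "x # P" "y # Q"] by simp
  show "path_edges (x # P @ [y]) \<union> path_edges (x # rev Q @ [y]) = cycle_edges (x # P @ y # Q)"
    unfolding 1 2 3 cycle_edges_def by auto
qed

lemma chord_inside:
  assumes cyc: "cycle_in E (x # P @ y # Q)" and ne: "P \<noteq> []" "Q \<noteq> []" and xy: "{x, y} \<in> E"
  shows "path_image (\<gamma> {x, y}) - {p x, p y} \<subseteq> inside (drawn (cycle_edges (x # P @ y # Q)))"
proof -
  note arcs = cycle_arcs[OF cyc]
  have chord: "path_in E (x # [] @ [y])" using xy by simp
  have tr: "drawn (path_edges (x # [] @ [y])) = path_image (\<gamma> {x, y})" by (simp add: drawn_def)
  let ?F = "path_edges (x # P @ [y])" and ?G = "path_edges (x # rev Q @ [y])"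
  obtain h where h: "arc h" "pathstart h = p x" "pathfinish h = p y" "path_image h = path_image (\<gamma> {x, y})"
    using edge_arc[OF xy] by blast
  have 1: "drawn (path_edges (x # [] @ [y])) \<inter> drawn ?F = {p x, p y}"
    by (rule paths_meet[OF _ _ chord arcs(1)]) (use arcs(3) ne in simp_all)
  have 2: "drawn (path_edges (x # [] @ [y])) \<inter> drawn ?G = {p x, p y}"
    by (rule paths_meet[OF _ _ chord arcs(2)]) (use arcs(3) ne in simp_all)
  have "drawn (path_edges (x # [] @ [y])) \<inter> inside (drawn ?F \<union> drawn ?G) \<noteq> {}"
    by (rule theta_last_inside[OF _ _ _ arcs(1,2) chord]) (use arcs(3) ne in simp_all)
  hence "path_image h \<inter> inside (drawn (?F \<union> ?G)) \<noteq> {}" unfolding tr h(4) drawn_Un .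
  moreover have "path_image h \<inter> drawn (?F \<union> ?G) = {p x, p y}"
    using 1 2 unfolding tr h(4) drawn_Un Int_Un_distrib by simp
  ultimately have "path_image h - {p x, p y} \<subseteq> inside (drawn (?F \<union> ?G))"
    by (intro arc_interior_inside[OF h(1-3)])
  thus ?thesis unfolding h(4) arcs(4) .
qed

text \<open>
Both chords are drawn inside the cycle. The chord \<open>{a, b}\<close> splits the interior into two
regions, and the chord \<open>{c, d}\<close> stays in one of them. The boundary of the first region does not
contain \<open>d\<close>, that of the second does not contain \<open>c\<close>, and neither vertex is in the interior,
so the chord cannot end there.
\<close>
lemma chords_do_not_cross:
  assumes cyc: "cycle_in E (a # B @ c # C @ b # D @ d # G)" and ab: "{a, b} \<in> E" and cd: "{c, d} \<in> E"
  shows False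
proof -
  let ?P = "B @ c # C" and ?Q = "D @ d # G"
  have cyc1: "cycle_in E (a # ?P @ b # ?Q)" using cyc by simp
  have rot: "c # (C @ b # D) @ d # (G @ a # B) = (c # C @ b # D @ d # G) @ (a # B)"
    "a # ?P @ b # ?Q = (a # B) @ (c # C @ b # D @ d # G)" by simp_all
  have cyc2: "cycle_in E (c # (C @ b # D) @ d # (G @ a # B))"
    unfolding rot(1) using cycle_in_rotate[of E "a # B" "c # C @ b # D @ d # G"] cyc by simp
  \<comment> \<open>The cycle is read once from \<open>a\<close> and once from \<open>c\<close>, so that
    both chords are inside the same closed curve.\<close>
  have same: "cycle_edges (c # (C @ b # D) @ d # (G @ a # B)) = cycle_edges (a # ?P @ b # ?Q)"
    unfolding rot by (rule cycle_edges_rotate) simp_all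
  note arcs = cycle_arcs[OF cyc1]
  let ?F = "path_edges (a # ?P @ [b])" and ?G = "path_edges (a # rev ?Q @ [b])"
  let ?H = "path_image (\<gamma> {a, b})"
  have chord: "path_in E (a # [] @ [b])" using ab by simp
  have tr: "drawn (path_edges (a # [] @ [b])) = ?H" by (simp add: drawn_def)
  have F: "?F \<subseteq> E" and G: "?G \<subseteq> E" by (rule path_edges_subset[OF arcs(1)], rule path_edges_subset[OF arcs(2)])
  have FG: "drawn ?F \<inter> drawn ?G = {p a, p b}"
    by (rule paths_meet[OF _ _ arcs(1,2)]) (use arcs(3) in simp_all)
  have dist0: "distinct (a # b # ?P @ [])" "distinct (a # b # rev ?Q @ [])" using arcs(3) by auto
  have FH: "drawn ?F \<inter> ?H = {p a, p b}"
    unfolding tr[symmetric] by (rule paths_meet[OF dist0(1) _ arcs(1) chord]) simp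
  have GH: "drawn ?G \<inter> ?H = {p a, p b}"
    unfolding tr[symmetric] by (rule paths_meet[OF dist0(2) _ arcs(2) chord]) simp
  have meets: "?H \<inter> inside (drawn ?F \<union> drawn ?G) \<noteq> {}"
  proof -
    have "distinct (a # b # ?P @ rev ?Q @ [])" using arcs(3) by (simp only: append_Nil2)
    from theta_last_inside[OF this _ _ arcs(1,2) chord] show ?thesis unfolding tr by simp
  qed
  have dist: "distinct (a # ?P @ [b])" "distinct (a # rev ?Q @ [b])" using arcs(3) by auto
  obtain f where f: "arc f" "pathstart f = p a" "pathfinish f = p b" "path_image f = drawn ?F"
    using path_arc[OF arcs(1) dist(1)] by (auto simp: last_append)
  obtain g where g: "arc g" "pathstart g = p a" "pathfinish g = p b" "path_image g = drawn ?G"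
    using path_arc[OF arcs(2) dist(2)] by (auto simp: last_append)
  obtain h where h: "arc h" "pathstart h = p a" "pathfinish h = p b" "path_image h = ?H"
    using edge_arc[OF ab] by blast
  obtain k where k: "arc k" "pathstart k = p c" "pathfinish k = p d" "path_image k = path_image (\<gamma> {c, d})"
    using edge_arc[OF cd] by blast
  have V: "a \<in> V" "b \<in> V" "c \<in> V" "d \<in> V" using edge_in[OF ab] edge_in[OF cd] by auto
  have neq: "p a \<noteq> p b" using inj_p V edge_in[OF ab] by (auto simp: inj_on_def)
  let ?I1 = "inside (drawn ?F \<union> ?H)" and ?I2 = "inside (drawn ?G \<union> ?H)"
  let ?X = "path_image k - {p c, p d}"
  have split: "?I1 \<inter> ?I2 = {} \<and> ?I1 \<union> ?I2 \<union> (?H - {p a, p b}) = inside (drawn ?F \<union> drawn ?G)"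
    by (rule split_inside_simple_closed_curve[of f "p a" "p b" g h])
      (use f g h neq FG FH GH meets in \<open>simp_all add: arc_imp_simple_path\<close>)
  have "?X \<subseteq> inside (drawn ?F \<union> drawn ?G)"
    using chord_inside[OF cyc2 _ _ cd] unfolding same arcs(4)[symmetric] drawn_Un k(4) by simp
  moreover have "path_image k \<inter> ?H = {}"
  proof -
    have "{c, d} \<inter> {a, b} = {}" using arcs(3) by auto
    moreover from this have "{c, d} \<noteq> {a, b}" by auto
    ultimately show ?thesis unfolding k(4) gamma_Int[OF cd ab \<open>{c, d} \<noteq> {a, b}\<close>] by simp
  qed
  ultimately have X: "?X \<subseteq> ?I1 \<union> ?I2" using split by auto
  have tr1: "drawn (insert {a, b} ?F) = drawn ?F \<union> ?H" "drawn (insert {a, b} ?G) = drawn ?G \<union> ?H"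
    by (auto simp: drawn_def)
  have E1: "insert {a, b} ?F \<subseteq> E" "insert {a, b} ?G \<subseteq> E" using F G ab by simp_all
  have cl: "closed (drawn ?F \<union> ?H)" "closed (drawn ?G \<union> ?H)"
    using closed_drawn[OF E1(1)] closed_drawn[OF E1(2)] unfolding tr1 .
  have conn: "connected ?X"
    using connected_simple_path_endless[OF arc_imp_simple_path[OF k(1)]] k(2,3) by simp
  have "?I1 \<inter> ?X = {} \<or> ?I2 \<inter> ?X = {}"
    by (rule connectedD[OF conn]) (use X split cl in \<open>auto intro: open_inside\<close>)
  hence in1: "?X \<subseteq> ?I1 \<or> ?X \<subseteq> ?I2" using X by auto
  have ends: "p c \<in> closure ?X" "p d \<in> closure ?X"
    using arc_ends_in_closure[OF k(1)] pathstart_in_path_image[of k] pathfinish_in_path_image[of k] k(2,3) by auto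
  have U: "\<Union> ?F = set (a # ?P @ [b])" "\<Union> ?G = set (a # rev ?Q @ [b])" by (rule Union_path_edges; simp)+
  have impossible: "\<not> ?X \<subseteq> inside (drawn S)"
    if S: "S \<subseteq> E" and v: "v \<in> V" "v \<notin> \<Union> S" "p v \<in> closure ?X" for S v
  proof
    assume "?X \<subseteq> inside (drawn S)"
    hence "closure ?X \<subseteq> drawn S \<union> inside (drawn S)"
      by (rule subset_trans[OF closure_mono closure_inside_subset[OF closed_drawn[OF S]]])
    thus False using v vertex_in_drawn_iff[OF S v(1)] vertex_not_inside[OF S v(1)] by auto
  qed
  have "d \<notin> \<Union> (insert {a, b} ?F)" "c \<notin> \<Union> (insert {a, b} ?G)" using U arcs(3) by auto
  thus False
    using in1 impossible[OF E1(1) V(4) _ ends(2)] impossible[OF E1(2) V(3) _ ends(1)] unfolding tr1 by auto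
qed

lemma crossing_free_edges: "crossing_free E"
  unfolding crossing_free_def
proof (intro allI impI notI, elim conjE)
  fix xs i j k l
  assume cyc: "cycle_in E xs" and o: "i < j" "j < k" "k < l" "l < length xs"
    and ik: "{xs ! i, xs ! k} \<in> E" and jl: "{xs ! j, xs ! l} \<in> E"
  have split: "take m xs = take n xs @ xs ! n # drop (Suc n) (take m xs)" if "n < m" "m \<le> length xs" for n m
    using id_take_nth_drop[of n "take m xs"] that by simp
  let ?B = "drop (Suc i) (take j xs)" and ?C = "drop (Suc j) (take k xs)"
    and ?D = "drop (Suc k) (take l xs)" and ?G = "drop (Suc l) xs"
  have "xs = take l xs @ xs ! l # ?G" using o by (intro id_take_nth_drop)
  also have "take l xs = take k xs @ xs ! k # ?D" using o by (intro split) auto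
  also have "take k xs = take j xs @ xs ! j # ?C" using o by (intro split) auto
  also have "take j xs = take i xs @ xs ! i # ?B" using o by (intro split) auto
  finally have "xs = take i xs @ (xs ! i # ?B @ xs ! j # ?C @ xs ! k # ?D @ xs ! l # ?G)" by simp
  hence "cycle_in E (take i xs @ (xs ! i # ?B @ xs ! j # ?C @ xs ! k # ?D @ xs ! l # ?G))"
    using cyc by (rule subst)
  from cycle_in_rotate[OF this]
  have "cycle_in E (xs ! i # ?B @ xs ! j # ?C @ xs ! k # ?D @ xs ! l # (?G @ take i xs))" by simp
  thus False by (rule chords_do_not_cross) (use ik jl in simp_all)
qed

end

section \<open>One-page drawings\<close>

definition one_page :: "'a set \<Rightarrow> 'a set set \<Rightarrow> ('a \<Rightarrow> int) \<Rightarrow> bool" where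
  "one_page V E pos \<longleftrightarrow> inj_on pos V \<and>
     (\<forall>a b c d. {a, c} \<in> E \<and> {b, d} \<in> E \<longrightarrow> \<not> (pos a < pos b \<and> pos b < pos c \<and> pos c < pos d))"

lemma one_page_subset:
  assumes "one_page V E pos" "W \<subseteq> V" "F \<subseteq> E"
  shows "one_page W F pos"
  using assms unfolding one_page_def by (meson inj_on_subset subsetD)

lemma simple_graph_induced: "simple_graph V E \<Longrightarrow> W \<subseteq> V \<Longrightarrow> simple_graph W {e \<in> E. e \<subseteq> W}"
  unfolding simple_graph_def by (auto intro: finite_subset)

text \<open>
A separation with at most one common vertex: the graph is disconnected or has a cut vertex.
\<close>
definition separation :: "'a set \<Rightarrow> 'a set set \<Rightarrow> 'a set \<Rightarrow> 'a set \<Rightarrow> bool" where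
  "separation V E V1 V2 \<longleftrightarrow> V1 \<union> V2 = V \<and> V1 \<noteq> V \<and> V2 \<noteq> V \<and>
     (\<exists>v. V1 \<inter> V2 \<subseteq> {v}) \<and> (\<forall>e\<in>E. e \<subseteq> V1 \<or> e \<subseteq> V2)"

lemma separationI:
  assumes "V1 \<union> V2 = V" "a \<in> V" "a \<notin> V1" "b \<in> V" "b \<notin> V2" "V1 \<inter> V2 \<subseteq> {v}"
    and "\<And>e. e \<in> E \<Longrightarrow> e \<subseteq> V1 \<or> e \<subseteq> V2"
  shows "separation V E V1 V2"
  using assms unfolding separation_def by blast

lemma separationD:
  assumes "separation V E V1 V2"
  shows "V1 \<union> V2 = V" "V1 \<noteq> V" "V2 \<noteq> V" "\<exists>v. V1 \<inter> V2 \<subseteq> {v}"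
    "\<And>e. e \<in> E \<Longrightarrow> e \<subseteq> V1 \<or> e \<subseteq> V2"
proof -
  note * = assms[unfolded separation_def]
  show "V1 \<union> V2 = V" "V1 \<noteq> V" "V2 \<noteq> V" "\<exists>v. V1 \<inter> V2 \<subseteq> {v}"
    by (rule *[THEN conjunct1], rule *[THEN conjunct2, THEN conjunct1],
        rule *[THEN conjunct2, THEN conjunct2, THEN conjunct1],
        rule *[THEN conjunct2, THEN conjunct2, THEN conjunct2, THEN conjunct1])
  show "e \<subseteq> V1 \<or> e \<subseteq> V2" if "e \<in> E" for e
    using *[THEN conjunct2, THEN conjunct2, THEN conjunct2, THEN conjunct2] that by (rule bspec)
qed

lemma rtrancl_imp_distinct_path:
  assumes "(w, s) \<in> Q\<^sup>*"
  shows "\<exists>p. p \<noteq> [] \<and> hd p = w \<and> last p = s \<and> distinct p \<and> successively (\<lambda>x y. (x, y) \<in> Q) p"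
  using assms
proof (induction rule: rtrancl_induct)
  case base
  show ?case by (rule exI[of _ "[w]"]) simp
next
  case (step s t)
  then obtain p where p: "p \<noteq> []" "hd p = w" "last p = s" "distinct p"
    "successively (\<lambda>x y. (x, y) \<in> Q) p" by blast
  show ?case
  proof (cases "t \<in> set p")
    case True
    then obtain us vs where eq: "p = (us @ [t]) @ vs" by (metis split_list append_Cons append_Nil append_assoc)
    have "successively (\<lambda>x y. (x, y) \<in> Q) (us @ [t])"
      using p(5) unfolding eq successively_append_iff by blast
    moreover have "hd (us @ [t]) = w" "distinct (us @ [t])" using p(2,4) unfolding eq by (cases us; simp)+
    ultimately show ?thesis by (intro exI[of _ "us @ [t]"]) simp
  next
    case False
    hence "p @ [t] \<noteq> [] \<and> hd (p @ [t]) = w \<and> last (p @ [t]) = t \<and> distinct (p @ [t]) \<and>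
        successively (\<lambda>x y. (x, y) \<in> Q) (p @ [t])"
      using p step by (auto simp: successively_append_iff)
    thus ?thesis by blast
  qed
qed

text \<open>
Start with an edge \<open>{x, w}\<close> that leaves \<open>C\<close>. The component \<open>T\<close> of \<open>w\<close> outside \<open>C\<close> has a
neighbor on \<open>C\<close> other than \<open>x\<close>, since otherwise \<open>x\<close> would separate it from the rest.
\<close>
lemma ear_exists:
  assumes simple: "simple_graph V E" and nosep: "\<And>V1 V2. \<not> separation V E V1 V2"
    and C: "C \<subseteq> V" "C \<noteq> V" "c \<in> C" "c' \<in> C" "c \<noteq> c'"
  obtains x y p where "x \<in> C" "y \<in> C" "x \<noteq> y" "p \<noteq> []" "distinct p" "set p \<inter> C = {}" "set p \<subseteq> V"
    "path_in E (x # p @ [y])"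
proof -
  have edge: "\<exists>s t. e = {s, t} \<and> s \<in> V \<and> t \<in> V" if "e \<in> E" for e
    using simple that unfolding simple_graph_def by (metis card_2_iff insert_subset)
  have "\<exists>x\<in>C. \<exists>w\<in>V - C. {x, w} \<in> E"
  proof (rule ccontr)
    assume no: "\<not> ?thesis"
    have "e \<subseteq> C \<or> e \<subseteq> V - C" if eE: "e \<in> E" for e
    proof -
      obtain s t where e: "e = {s, t}" "s \<in> V" "t \<in> V" using edge[OF eE] by blast
      have "{t, s} \<in> E" "{s, t} \<in> E" using eE e(1) by (simp_all add: insert_commute)
      hence "s \<in> C \<longleftrightarrow> t \<in> C" using no e by blast
      thus ?thesis using e by auto
    qed
    moreover obtain w where "w \<in> V" "w \<notin> C" using C(1,2) by blast
    ultimately have "separation V E C (V - C)"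
      by (intro separationI[of _ _ _ w c]) (use C in auto)
    thus False using nosep by blast
  qed
  then obtain x w where x: "x \<in> C" and w: "w \<in> V" "w \<notin> C" and xw: "{x, w} \<in> E" by blast
  define Q where "Q = {(s, t). {s, t} \<in> E \<and> s \<notin> C \<and> t \<notin> C}"
  define T where "T = Q\<^sup>* `` {w}"
  have TV: "t \<in> V \<and> t \<notin> C" if "t \<in> T" for t
  proof -
    have "(w, t) \<in> Q\<^sup>*" using that by (simp add: T_def)
    thus ?thesis
    proof (induction rule: rtrancl_induct)
      case (step y z)
      hence "{y, z} \<in> E" "z \<notin> C" by (auto simp: Q_def)
      thus ?case using simple unfolding simple_graph_def by blast
    qed (use w in blast)
  qed
  have "\<exists>s\<in>T. \<exists>y\<in>C. y \<noteq> x \<and> {s, y} \<in> E"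
  proof (rule ccontr)
    assume no: "\<not> ?thesis"
    have cl: "t \<in> insert x T" if "s \<in> T" "{s, t} \<in> E" for s t
    proof (cases "t \<in> C")
      case True thus ?thesis using no that by blast
    next
      case False
      hence "(s, t) \<in> Q" using that TV unfolding Q_def by blast
      thus ?thesis using that(1) unfolding T_def by (auto intro: rtrancl_into_rtrancl)
    qed
    have "e \<subseteq> insert x T \<or> e \<subseteq> V - T" if eE: "e \<in> E" for e
    proof -
      obtain s t where e: "e = {s, t}" "s \<in> V" "t \<in> V" using edge[OF eE] by blast
      show ?thesis using cl[of s t] cl[of t s] eE e by (auto simp: insert_commute)
    qed
    moreover obtain a where "a \<in> C" "a \<noteq> x" using C by metis
    moreover have "w \<in> T" by (simp add: T_def)
    ultimately have "separation V E (insert x T) (V - T)"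
      by (intro separationI[of _ _ _ a w x]) (use TV C(1) x w in auto)
    thus False using nosep by blast
  qed
  then obtain s y where s: "(w, s) \<in> Q\<^sup>*" and y: "y \<in> C" "y \<noteq> x" and sy: "{s, y} \<in> E"
    unfolding T_def by blast
  obtain p where p: "p \<noteq> []" "hd p = w" "last p = s" "distinct p" "successively (\<lambda>x y. (x, y) \<in> Q) p"
    using rtrancl_imp_distinct_path[OF s] by blast
  have "path_in E p" using p(5) by (rule successively_mono) (auto simp: Q_def)
  hence path: "path_in E (x # p @ [y])"
    using p xw sy by (auto simp: successively_append_iff successively_Cons)
  have "set p \<subseteq> T"
  proof
    fix t assume "t \<in> set p"
    then obtain us vs where eq: "p = (us @ [t]) @ vs" by (metis split_list append_Cons append_Nil append_assoc)
    have q: "successively (\<lambda>x y. (x, y) \<in> Q) (us @ [t])"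
      using p(5) unfolding eq successively_append_iff by blast
    have q': "hd (us @ [t]) = w" using p(2) unfolding eq by (cases us) auto
    have "(hd zs, last zs) \<in> Q\<^sup>*" if "successively (\<lambda>x y. (x, y) \<in> Q) zs" "zs \<noteq> []" for zs
      using that
    proof (induction zs rule: induct_list012)
      case (3 a b zs)
      thus ?case by (auto intro: converse_rtrancl_into_rtrancl)
    qed auto
    from this[OF q] show "t \<in> T" using q' by (simp add: T_def)
  qed
  hence "set p \<inter> C = {}" "set p \<subseteq> V" using TV by blast+
  with that[OF x y(1) y(2)[symmetric] p(1,4) _ _ path] show thesis by blast
qed

text \<open>
A longest cycle, where a single edge counts as a cycle of length 2. If it missed a vertex,
an ear between \<open>u\<close> and \<open>v\<close> could replace the part of the cycle between them when that part has no inner vertex,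
giving a longer cycle. Otherwise the ear and the two parts of the cycle form a theta.
\<close>
lemma hamiltonian_cycle_exists:
  assumes simple: "simple_graph V E" and nosep: "\<And>V1 V2. \<not> separation V E V1 V2"
    and V: "2 \<le> card V" and tf: "theta_free E"
  obtains xs where "cycle_in E xs" "set xs = V"
proof -
  have fin: "finite V" using simple by (simp add: simple_graph_def)
  have "\<exists>e. e \<in> E"
  proof (rule ccontr)
    assume no: "\<not> ?thesis"
    obtain x y where xy: "x \<in> V" "y \<in> V" "x \<noteq> y"
    proof -
      have "\<not> card V \<le> Suc 0" using V by simp
      thus thesis using that unfolding card_le_Suc0_iff_eq[OF fin] by blast
    qed
    have "separation V E {x} (V - {x})"
      by (rule separationI[of _ _ _ y x x]) (use xy no in auto)
    thus False using nosep by blast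
  qed
  then obtain e where "e \<in> E" "e \<subseteq> V" "card e = 2" using simple unfolding simple_graph_def by blast
  then obtain x y where xy: "{x, y} \<in> E" "x \<noteq> y" "x \<in> V" "y \<in> V"
    unfolding card_2_iff by auto
  define P where "P xs \<longleftrightarrow> cycle_in E xs \<and> set xs \<subseteq> V" for xs
  have "P [x, y]" using xy by (simp add: P_def cycle_in_def insert_commute)
  moreover have "\<forall>xs. P xs \<longrightarrow> length xs < Suc (card V)"
  proof (intro allI impI)
    fix xs assume "P xs"
    hence "distinct xs" "set xs \<subseteq> V" by (auto simp: P_def cycle_in_def)
    thus "length xs < Suc (card V)"
      using card_mono[OF fin, of "set xs"] distinct_card[of xs] by simp
  qed
  ultimately have "\<exists>xs. P xs \<and> (\<forall>ys. P ys \<longrightarrow> length ys \<le> length xs)"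
    by (rule ex_has_greatest_nat[where f = length and P = P])
  then obtain xs where xs: "P xs" and max: "\<And>ys. P ys \<Longrightarrow> length ys \<le> length xs" by blast
  have "set xs = V"
  proof (rule ccontr)
    assume ne: "set xs \<noteq> V"
    have cyc: "cycle_in E xs" "set xs \<subseteq> V" using xs by (auto simp: P_def)
    obtain a ys where ys: "xs = a # ys" "ys \<noteq> []" "a \<notin> set ys"
      using cyc(1) unfolding cycle_in_def by (cases xs; cases "tl xs") auto
    hence "hd xs \<in> set xs" "last xs \<in> set xs" "hd xs \<noteq> last xs"
      using last_in_set[OF ys(2)] by auto
    then obtain u v p where uv: "u \<in> set xs" "v \<in> set xs" "u \<noteq> v" and
      p: "p \<noteq> []" "distinct p" "set p \<inter> set xs = {}" "set p \<subseteq> V" "path_in E (u # p @ [v])"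
      by (rule ear_exists[OF simple nosep cyc(2) ne])
    obtain q r where qr: "cycle_in E (u # q @ v # r)" "set (u # q @ v # r) = set xs"
      "length (u # q @ v # r) = length xs"
      by (rule cycle_in_split[OF cyc(1) uv])
    have sp: "set p \<inter> set (u # q @ v # r) = {}" using p(3) qr(2) by simp
    consider "q = []" | "r = []" | "q \<noteq> []" "r \<noteq> []" by blast
    thus False
    proof cases
      case 1
      have "path_in E (u # p @ v # r)"
        using path_in_join[of E "u # p" v r] p(5) qr(1) 1 by (simp add: cycle_in_def)
      moreover have "distinct (u # p @ v # r)" using qr(1) p(2) sp by (auto simp: cycle_in_def)
      moreover have "{last (u # p @ v # r), u} \<in> E" using qr(1) 1 by (simp add: cycle_in_def)
      moreover have "set (u # p @ v # r) \<subseteq> V" using qr(2) cyc(2) p(4) by auto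
      ultimately have "P (u # p @ v # r)" by (simp add: P_def cycle_in_def)
      thus False using max[of "u # p @ v # r"] qr(3) 1 p(1) by (cases p) auto
    next
      case 2
      have "path_in E (v # rev p @ [u])" using path_in_rev[OF p(5)] by simp
      hence rp: "path_in E (v # rev p)" "{last (v # rev p), u} \<in> E"
        using successively_append_iff[of "\<lambda>x y. {x, y} \<in> E" "v # rev p" "[u]"] by auto
      have "path_in E (u # q @ v # rev p)"
        using path_in_join[of E "u # q" v "rev p"] rp(1) qr(1) 2 by (simp add: cycle_in_def)
      moreover have "distinct (u # q @ v # rev p)" using qr(1) p(2) sp by (auto simp: cycle_in_def)
      moreover have "{last (u # q @ v # rev p), u} \<in> E" using rp(2) p(1) by simp
      moreover have "set (u # q @ v # rev p) \<subseteq> V" using qr(2) cyc(2) p(4) by auto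
      ultimately have "P (u # q @ v # rev p)" by (simp add: P_def cycle_in_def)
      thus False using max[of "u # q @ v # rev p"] qr(3) 2 p(1) by (cases p) auto
    next
      case 3
      have d: "distinct (u # v # p @ q @ rev r)" using qr(1) p(2) sp unfolding cycle_in_def by auto
      have "path_in E ((u # q) @ [v] @ r)" "{last r, u} \<in> E"
        using qr(1) 3 by (simp_all add: cycle_in_def)
      hence "path_in E (v # r @ [u])" "path_in E (u # q @ [v])"
        unfolding path_in_join using 3(2) successively_append_iff[of "\<lambda>x y. {x, y} \<in> E" "v # r" "[u]"]
        by auto
      moreover from this(1) have "path_in E (u # rev r @ [v])" using path_in_rev[of E "v # r @ [u]"] by simp
      moreover have "rev r \<noteq> []" using 3 by simp
      ultimately show False
        using tf d p(1,5) 3(1) unfolding theta_free_def by blast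
    qed
  qed
  thus thesis using that xs by (simp add: P_def)
qed

lemma cycle_one_page:
  assumes simple: "simple_graph V E" and xs: "cycle_in E xs" "set xs = V" and cf: "crossing_free E"
  shows "\<exists>pos. one_page V E pos"
proof -
  define ix where "ix x = (THE i. i < length xs \<and> xs ! i = x)" for x
  have ix: "ix x < length xs \<and> xs ! ix x = x" if "x \<in> V" for x
    unfolding ix_def
  proof (rule theI')
    show "\<exists>!i. i < length xs \<and> xs ! i = x"
      by (rule distinct_Ex1) (use that xs in \<open>auto simp: cycle_in_def\<close>)
  qed
  have in_V: "x \<in> V \<and> y \<in> V" if "{x, y} \<in> E" for x y
    using simple that unfolding simple_graph_def by blast
  have "one_page V E (\<lambda>x. int (ix x))"
    unfolding one_page_def
  proof (intro conjI allI impI notI)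
    show "inj_on (\<lambda>x. int (ix x)) V"
    proof (rule inj_onI)
      fix x y assume *: "x \<in> V" "y \<in> V" "int (ix x) = int (ix y)"
      have "x = xs ! ix x" using ix[OF *(1)] by simp
      also have "ix x = ix y" using *(3) by simp
      also have "xs ! ix y = y" using ix[OF *(2)] by simp
      finally show "x = y" .
    qed
  next
    fix a b c d
    assume e: "{a, c} \<in> E \<and> {b, d} \<in> E"
      and o: "int (ix a) < int (ix b) \<and> int (ix b) < int (ix c) \<and> int (ix c) < int (ix d)"
    have V: "a \<in> V" "b \<in> V" "c \<in> V" "d \<in> V" using e in_V by blast+
    have "ix a < ix b" "ix b < ix c" "ix c < ix d" "ix d < length xs"
      using o ix[OF V(4)] by auto
    hence "\<not> ({xs ! ix a, xs ! ix c} \<in> E \<and> {xs ! ix b, xs ! ix d} \<in> E)"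
      using cf[unfolded crossing_free_def, rule_format, of xs "ix a" "ix b" "ix c" "ix d"] xs(1) by blast
    moreover have "xs ! ix a = a" "xs ! ix b = b" "xs ! ix c = c" "xs ! ix d = d" using ix V by blast+
    ultimately show False using e by simp
  qed
  thus ?thesis by blast
qed

text \<open>
Crossing of two chords depends only on the cyclic order of their ends, so the
drawing may be rotated to begin at any vertex.
\<close>
lemma one_page_rotate:
  assumes simple: "simple_graph V E" and page: "one_page V E pos" and v: "v \<in> V"
  shows "\<exists>pos' N. one_page V E pos' \<and> pos' v = 0 \<and> (\<forall>x\<in>V. 0 \<le> pos' x \<and> pos' x < N)"
proof -
  have fin: "finite V" using simple by (simp add: simple_graph_def)
  have in_V: "x \<in> V \<and> y \<in> V" if "{x, y} \<in> E" for x y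
    using simple that unfolding simple_graph_def by blast
  \<comment> \<open>All positions lie strictly between \<open>- M\<close> and \<open>M\<close>, so a shift by \<open>2 * M\<close> moves
    the vertices before \<open>v\<close> behind all others.\<close>
  define M where "M = Suc (Max ((\<lambda>x. nat \<bar>pos x\<bar>) ` V))"
  have M: "\<bar>pos x\<bar> < int M" if "x \<in> V" for x
  proof -
    have "nat \<bar>pos x\<bar> \<le> Max ((\<lambda>x. nat \<bar>pos x\<bar>) ` V)" using fin that by simp
    thus ?thesis by (simp add: M_def)
  qed
  define pos' where "pos' x = (if pos v \<le> pos x then pos x - pos v else pos x - pos v + 2 * int M)" for x
  have nc: "{a, c} \<in> E \<Longrightarrow> {b, d} \<in> E \<Longrightarrow> pos a < pos b \<Longrightarrow> pos b < pos c \<Longrightarrow> pos c < pos d \<Longrightarrow> False"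
    for a b c d using page unfolding one_page_def by blast
  have "one_page V E pos'"
    unfolding one_page_def
  proof (intro conjI allI impI notI)
    show "inj_on pos' V"
    proof (rule inj_onI)
      fix x y assume *: "x \<in> V" "y \<in> V" "pos' x = pos' y"
      have "pos x = pos y" using *(3) M[OF *(1)] M[OF *(2)] unfolding pos'_def by (simp split: if_splits)
      thus "x = y" using page * unfolding one_page_def by (simp add: inj_on_def)
    qed
  next
    fix a b c d
    assume e: "{a, c} \<in> E \<and> {b, d} \<in> E" and o: "pos' a < pos' b \<and> pos' b < pos' c \<and> pos' c < pos' d"
    have V: "a \<in> V" "b \<in> V" "c \<in> V" "d \<in> V" using e in_V by blast+
    have e': "{c, a} \<in> E" "{d, b} \<in> E" using e by (auto simp: insert_commute)
    note M' = M[OF V(1)] M[OF V(2)] M[OF V(3)] M[OF V(4)] M[OF v]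
    \<comment> \<open>The four ends keep their cyclic order.\<close>
    have "(pos a < pos b \<and> pos b < pos c \<and> pos c < pos d) \<or> (pos d < pos a \<and> pos a < pos b \<and> pos b < pos c) \<or>
      (pos c < pos d \<and> pos d < pos a \<and> pos a < pos b) \<or> (pos b < pos c \<and> pos c < pos d \<and> pos d < pos a)"
      using o M' unfolding pos'_def by smt
    thus False using nc[of a c b d] nc[of d b a c] nc[of c a d b] nc[of b d c a] e e' by blast
  qed
  moreover have "\<forall>x\<in>V. 0 \<le> pos' x \<and> pos' x < 4 * int M"
  proof
    fix x assume x: "x \<in> V"
    show "0 \<le> pos' x \<and> pos' x < 4 * int M" using M[OF x] M[OF v] unfolding pos'_def by (simp add: abs_less_iff)
  qed
  moreover have "pos' v = 0" by (simp add: pos'_def)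
  ultimately show ?thesis by (intro exI[of _ pos'] exI[of _ "4 * int M"] conjI)
qed

lemma one_page_shift: "one_page V E pos \<Longrightarrow> one_page V E (\<lambda>x. pos x + k)"
  by (simp add: one_page_def inj_on_def)

text \<open>
The drawing of the second part, rotated to begin at the common vertex \<open>v\<close>, is inserted
directly behind \<open>v\<close>; stretching the first drawing by a factor \<open>N\<close> makes room for it. If the two
parts are disjoint, any vertex of the first part serves as \<open>v\<close>.
\<close>
lemma one_page_glue:
  assumes simple: "simple_graph V E" and sep: "separation V E V1 V2"
    and p1: "one_page V1 {e \<in> E. e \<subseteq> V1} pos1" and p2: "one_page V2 {e \<in> E. e \<subseteq> V2} pos2"
  shows "\<exists>pos. one_page V E pos"
proof -
  let ?E1 = "{e \<in> E. e \<subseteq> V1}" and ?E2 = "{e \<in> E. e \<subseteq> V2}"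
  note E = separationD(5)[OF sep]
  have V: "V1 \<union> V2 = V" "V1 \<noteq> {}" "V2 \<noteq> {}" using separationD(1-3)[OF sep] by auto
  have s2: "simple_graph V2 ?E2" using simple V(1) by (intro simple_graph_induced) auto
  have "\<exists>v q N. v \<in> V1 \<and> V1 \<inter> V2 \<subseteq> {v} \<and> one_page V2 ?E2 q \<and> (v \<in> V2 \<longrightarrow> q v = 0) \<and>
      (\<forall>x\<in>V2. 0 \<le> q x \<and> q x < N \<and> (x \<noteq> v \<longrightarrow> 0 < q x))"
  proof (cases "V1 \<inter> V2 = {}")
    case True
    obtain v w where v: "v \<in> V1" "w \<in> V2" using V by blast
    obtain q N where q: "one_page V2 ?E2 q" and qN: "\<forall>x\<in>V2. 0 \<le> q x \<and> q x < N"
      using one_page_rotate[OF s2 p2 v(2)] by (elim exE conjE)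
    have "one_page V2 ?E2 (\<lambda>x. q x + 1)" using q by (rule one_page_shift)
    moreover have "0 \<le> q x + 1 \<and> q x + 1 < N + 1 \<and> (x \<noteq> v \<longrightarrow> 0 < q x + 1)" if "x \<in> V2" for x
      using bspec[OF qN that] by simp
    moreover have "v \<notin> V2" using v True by blast
    ultimately show ?thesis using True v
      by (intro exI[of _ v] exI[of _ "\<lambda>x. q x + 1"] exI[of _ "N + 1"]) simp
  next
    case False
    obtain v where "V1 \<inter> V2 \<subseteq> {v}" using separationD(4)[OF sep] by blast
    with False have v: "v \<in> V1" "v \<in> V2" "V1 \<inter> V2 \<subseteq> {v}" by auto
    obtain q N where q: "one_page V2 ?E2 q" "q v = 0" "\<forall>x\<in>V2. 0 \<le> q x \<and> q x < N"
      using one_page_rotate[OF s2 p2 v(2)] by (elim exE conjE)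
    have "0 < q x" if "x \<in> V2" "x \<noteq> v" for x
    proof -
      have "q x \<noteq> q v" using q(1) that v(2) unfolding one_page_def by (metis inj_onD)
      thus ?thesis using q(2) bspec[OF q(3) that(1)] by simp
    qed
    thus ?thesis using v q by (intro exI[of _ v] exI[of _ q] exI[of _ N]) simp
  qed
  then obtain v q N where v: "v \<in> V1" "V1 \<inter> V2 \<subseteq> {v}" and q: "one_page V2 ?E2 q" "v \<in> V2 \<longrightarrow> q v = 0"
    and qN': "\<forall>x\<in>V2. 0 \<le> q x \<and> q x < N \<and> (x \<noteq> v \<longrightarrow> 0 < q x)" by (elim exE conjE)
  have qN: "0 \<le> q x" "q x < N" "x \<noteq> v \<Longrightarrow> 0 < q x" if "x \<in> V2" for x
    using bspec[OF qN' that] by simp_all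
  obtain w where "w \<in> V2" using V by blast
  hence N: "0 < N" using qN(1,2)[of w] by linarith
  define pos where "pos x = (if x \<in> V1 then N * pos1 x else N * pos1 v + q x)" for x
  have pos1: "pos x = N * pos1 x" if "x \<in> V1" for x using that by (simp add: pos_def)
  have pos2: "pos x = N * pos1 v + q x" if "x \<in> V2" for x
    using that v q(2) by (auto simp: pos_def)
  have gap: "\<not> (N * k + s < N * m \<and> N * m < N * k + t)" if "0 \<le> s" "t < N" for k m s t :: int
  proof
    assume *: "N * k + s < N * m \<and> N * m < N * k + t"
    moreover have "N * (k + 1) = N * k + N" by (simp add: distrib_left)
    ultimately have "N * k < N * m" "N * m < N * (k + 1)" using that by linarith+
    thus False using N by (simp add: mult_less_cancel_left_pos)
  qed
  have mono: "pos1 x < pos1 y" if "x \<in> V1" "y \<in> V1" "pos x < pos y" for x y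
    using that N by (simp add: pos1 mult_less_cancel_left_pos)
  have "one_page V E pos"
    unfolding one_page_def
  proof (intro conjI allI impI notI)
    show "inj_on pos V"
    proof (rule inj_onI)
      have mixed: "pos x \<noteq> pos y" if "x \<in> V1" "y \<in> V2" "y \<notin> V1" for x y
      proof
        assume "pos x = pos y"
        hence eq: "N * pos1 x = N * pos1 v + q y" using that by (simp add: pos1 pos2)
        have y: "0 < q y" "q y < N" using qN[OF that(2)] that v(1) by auto
        have "N * (pos1 v + 1) = N * pos1 v + N" by (simp add: distrib_left)
        hence "N * pos1 v < N * pos1 x" "N * pos1 x < N * (pos1 v + 1)" using eq y by linarith+
        thus False using N by (simp add: mult_less_cancel_left_pos)
      qed
      fix x y assume *: "x \<in> V" "y \<in> V" "pos x = pos y"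
      consider "x \<in> V1" "y \<in> V1" | "x \<in> V2" "y \<in> V2"
        using * mixed[of x y] mixed[of y x] V(1) by fastforce
      thus "x = y"
      proof cases
        case 1
        thus ?thesis using *(3) N p1 by (simp add: pos1 one_page_def inj_on_def)
      next
        case 2
        thus ?thesis using *(3) q(1) by (simp add: pos2 one_page_def inj_on_def)
      qed
    qed
  next
    fix a b c d
    assume e: "{a, c} \<in> E \<and> {b, d} \<in> E" and o: "pos a < pos b \<and> pos b < pos c \<and> pos c < pos d"
    \<comment> \<open>Both edges lie in the same part, or the ends of one edge lie in the
      inserted block, which contains no vertex of the first part except \<open>v\<close> at its beginning.\<close>
    consider "a \<in> V1" "c \<in> V1" "b \<in> V1" "d \<in> V1" | "a \<in> V2" "c \<in> V2" "b \<in> V2" "d \<in> V2"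
      | "a \<in> V1" "c \<in> V1" "b \<in> V2" "d \<in> V2" | "a \<in> V2" "c \<in> V2" "b \<in> V1" "d \<in> V1"
      using e E[of "{a, c}"] E[of "{b, d}"] by auto
    thus False
    proof cases
      case 1
      have "pos1 a < pos1 b" "pos1 b < pos1 c" "pos1 c < pos1 d" using mono 1 o by auto
      thus False using p1 e 1 unfolding one_page_def by simp blast
    next
      case 2
      have "q a < q b" "q b < q c" "q c < q d" using 2 o by (auto simp: pos2)
      thus False using q(1) e 2 unfolding one_page_def by simp blast
    next
      case 3
      thus False using gap[of "q b" "q d" "pos1 v" "pos1 c"] qN(1)[of b] qN(2)[of d] o
        by (simp add: pos1 pos2)
    next
      case 4
      thus False using gap[of "q a" "q c" "pos1 v" "pos1 b"] qN(1)[of a] qN(2)[of c] o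
        by (simp add: pos1 pos2)
    qed
  qed
  thus ?thesis by blast
qed

text \<open>
Induction on the number of vertices: separations are glued, and a graph without separation
is ordered along a Hamiltonian cycle.
\<close>
lemma one_page_exists:
  assumes "simple_graph V E" "theta_free E" "crossing_free E"
  shows "\<exists>pos. one_page V E pos"
  using assms
proof (induction "card V" arbitrary: V E rule: less_induct)
  case less
  have fin: "finite V" using less by (simp add: simple_graph_def)
  consider "card V \<le> 1" | V1 V2 where "separation V E V1 V2" | "2 \<le> card V" "\<And>V1 V2. \<not> separation V E V1 V2"
  proof -
    show thesis
    proof (cases "\<exists>V1 V2. separation V E V1 V2")
      case True
      then obtain V1 V2 where "separation V E V1 V2" by (elim exE)
      thus thesis by (rule that(2))
    next
      case False
      show thesis
      proof (cases "card V \<le> 1")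
        case True thus thesis by (rule that(1))
      next
        case nt: False
        show thesis
        proof (rule that(3))
          show "2 \<le> card V" using nt by simp
          show "\<not> separation V E V1 V2" for V1 V2 using False by (metis (no_types))
        qed
      qed
    qed
  qed
  thus ?case
  proof cases
    case 1
    have V1: "x = y" if "x \<in> V" "y \<in> V" for x y
    proof -
      have "card V \<le> Suc 0" using 1 by simp
      hence "\<forall>x\<in>V. \<forall>y\<in>V. x = y" by (rule card_le_Suc0_iff_eq[OF fin, THEN iffD1])
      from bspec[OF bspec[OF this that(1)] that(2)] show ?thesis .
    qed
    have "E = {}"
    proof (rule ccontr)
      assume "E \<noteq> {}"
      then obtain e where "e \<subseteq> V" "card e = 2" using less(2) unfolding simple_graph_def by blast
      thus False using 1 card_mono[OF fin, of e] by simp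
    qed
    moreover have "inj_on (\<lambda>x. 0 :: int) V" by (rule inj_onI) (rule V1)
    ultimately have "one_page V E (\<lambda>x. 0)" by (simp add: one_page_def)
    thus ?thesis by blast
  next
    case (2 V1 V2)
    have sub: "\<exists>pos. one_page W {e \<in> E. e \<subseteq> W} pos" if "W \<subset> V" for W
    proof (rule less(1))
      show "card W < card V" using fin that by (rule psubset_card_mono)
      show "simple_graph W {e \<in> E. e \<subseteq> W}" using less(2) that by (intro simple_graph_induced) auto
      show "theta_free {e \<in> E. e \<subseteq> W}" using less(3) by (rule theta_free_subset) auto
      show "crossing_free {e \<in> E. e \<subseteq> W}" using less(4) by (rule crossing_free_subset) auto
    qed
    have "V1 \<subset> V" "V2 \<subset> V" using separationD(1-3)[OF 2] by auto
    then obtain pos1 pos2 where "one_page V1 {e \<in> E. e \<subseteq> V1} pos1" "one_page V2 {e \<in> E. e \<subseteq> V2} pos2"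
      using sub[of V1] sub[of V2] by (elim exE meta_impE)
    thus ?thesis by (rule one_page_glue[OF less(2) 2])
  next
    case 3
    obtain xs where "cycle_in E xs" "set xs = V" by (rule hamiltonian_cycle_exists[OF less(2) 3(2,1) less(3)])
    thus ?thesis by (rule cycle_one_page[OF less(2) _ _ less(4)])
  qed
qed

section \<open>Coloring a layered one-page drawing\<close>

definition later_children :: "'a set set \<Rightarrow> ('a \<Rightarrow> nat) \<Rightarrow> ('a \<Rightarrow> int) \<Rightarrow> 'a \<Rightarrow> 'a set" where
  "later_children E lev pos v = {z. {v, z} \<in> E \<and> lev z = Suc (lev v) \<and> pos v < pos z}"

definition later_siblings :: "'a set set \<Rightarrow> ('a \<Rightarrow> nat) \<Rightarrow> ('a \<Rightarrow> int) \<Rightarrow> 'a \<Rightarrow> 'a set" where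
  "later_siblings E lev pos v = {w. {v, w} \<in> E \<and> lev w = lev v \<and> pos v < pos w}"

text \<open>
The color of the first edge to a child on the later side of \<open>v\<close>, given the peaks \<open>f\<close>
of the vertices at the level of \<open>v\<close>. Edges within a level get the larger of the two peaks, so
this is the successor of the color of the edge to the later sibling, if there is one.
\<close>
definition side_start ::
  "'a set set \<Rightarrow> ('a \<Rightarrow> nat) \<Rightarrow> ('a \<Rightarrow> int) \<Rightarrow> ('a \<Rightarrow> nat) \<Rightarrow> 'a \<Rightarrow> nat" where
  "side_start E lev pos f v = Suc (Max (f ` insert v (later_siblings E lev pos v)))"

definition side_color ::
  "'a set set \<Rightarrow> ('a \<Rightarrow> nat) \<Rightarrow> ('a \<Rightarrow> int) \<Rightarrow> ('a \<Rightarrow> nat) \<Rightarrow> 'a \<Rightarrow> 'a \<Rightarrow> nat" where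
  "side_color E lev pos f v z =
     side_start E lev pos f v + card {y \<in> later_children E lev pos v. pos z < pos y}"

text \<open>
For a child on the left of \<open>v\<close> the order is reversed, so that on both sides the colors
increase towards \<open>v\<close>.
\<close>
definition down_color ::
  "'a set set \<Rightarrow> ('a \<Rightarrow> nat) \<Rightarrow> ('a \<Rightarrow> int) \<Rightarrow> ('a \<Rightarrow> nat) \<Rightarrow> 'a \<Rightarrow> 'a \<Rightarrow> nat" where
  "down_color E lev pos f v z =
     (if pos v < pos z then side_color E lev pos f v z
      else side_color E lev (\<lambda>x. - pos x) f v z)"

definition parents :: "'a set set \<Rightarrow> ('a \<Rightarrow> nat) \<Rightarrow> 'a \<Rightarrow> 'a set" where
  "parents E lev z = {p. {p, z} \<in> E \<and> lev z = Suc (lev p)}"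

text \<open>
The peak of \<open>z\<close> is the largest color on the edges to its parents, and 0 for the root. It is
defined along the levels, since these colors depend on the peaks one level higher up. Only the
values of \<open>peak_at E lev pos l\<close> at level \<open>l\<close> are meaningful.
\<close>
primrec peak_at ::
  "'a set set \<Rightarrow> ('a \<Rightarrow> nat) \<Rightarrow> ('a \<Rightarrow> int) \<Rightarrow> nat \<Rightarrow> 'a \<Rightarrow> nat" where
  "peak_at E lev pos 0 = (\<lambda>z. 0)"
| "peak_at E lev pos (Suc l) =
     (\<lambda>z. Max ((\<lambda>p. down_color E lev pos (peak_at E lev pos l) p z) ` parents E lev z))"

definition peak :: "'a set set \<Rightarrow> ('a \<Rightarrow> nat) \<Rightarrow> ('a \<Rightarrow> int) \<Rightarrow> 'a \<Rightarrow> nat" where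
  "peak E lev pos z = peak_at E lev pos (lev z) z"

lemma bij_betw_rank:
  fixes k :: "'a \<Rightarrow> int"
  assumes "finite X" "inj_on k X"
  shows "bij_betw (\<lambda>z. card {y \<in> X. k z < k y}) X {..<card X}"
proof -
  let ?f = "\<lambda>z. card {y \<in> X. k z < k y}"
  have less: "?f y < ?f x" if "x \<in> X" "y \<in> X" "k x < k y" for x y
  proof (rule psubset_card_mono)
    show "finite {w \<in> X. k x < k w}" using assms by simp
    have "y \<in> {w \<in> X. k x < k w}" "y \<notin> {w \<in> X. k y < k w}" using that by simp_all
    moreover have "{w \<in> X. k y < k w} \<subseteq> {w \<in> X. k x < k w}" using that by auto
    ultimately show "{w \<in> X. k y < k w} \<subset> {w \<in> X. k x < k w}" by blast
  qed
  have inj: "inj_on ?f X"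
  proof (rule inj_onI)
    fix x y assume *: "x \<in> X" "y \<in> X" "?f x = ?f y"
    have "\<not> k x < k y" "\<not> k y < k x" using less[of x y] less[of y x] * by auto
    thus "x = y" using * assms(2) by (simp add: inj_on_def)
  qed
  have "?f z < card X" if "z \<in> X" for z
  proof (rule psubset_card_mono[OF assms(1)])
    have "z \<notin> {y \<in> X. k z < k y}" by simp
    thus "{y \<in> X. k z < k y} \<subset> X" using that by blast
  qed
  hence "?f ` X \<subseteq> {..<card X}" by auto
  hence "?f ` X = {..<card X}"
    by (intro card_subset_eq) (use inj in \<open>auto simp: card_image\<close>)
  thus ?thesis using inj by (simp add: bij_betw_def)
qed

text \<open>
The order \<open>pos\<close> gives a one-page drawing with root \<open>r\<close> at level 0. The condition
\<open>cover\<close> holds for distances because the shortest path from a vertex under an edge to the root must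
leave through an end of the edge. All conditions are invariant under reflection of the line, so
every lemma about the right side of a vertex yields one about its left side.
\<close>
locale layered =
  fixes V :: "'a set" and E :: "'a set set" and lev :: "'a \<Rightarrow> nat" and pos :: "'a \<Rightarrow> int" and r :: 'a
  assumes simple: "simple_graph V E"
    and inj_pos: "inj_on pos V"
    and noncrossing: "{a, c} \<in> E \<Longrightarrow> {b, d} \<in> E \<Longrightarrow> pos a < pos b \<Longrightarrow> pos b < pos c \<Longrightarrow> pos c < pos d \<Longrightarrow> False"
    and lev_edge: "{x, y} \<in> E \<Longrightarrow> lev y \<le> Suc (lev x)"
    and lev_0: "v \<in> V \<Longrightarrow> lev v = 0 \<Longrightarrow> v = r"
    and has_parent: "v \<in> V \<Longrightarrow> lev v = Suc l \<Longrightarrow> \<exists>p. {p, v} \<in> E \<and> lev p = l"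
    and cover: "{x, y} \<in> E \<Longrightarrow> w \<in> V \<Longrightarrow> pos x < pos w \<Longrightarrow> pos w < pos y \<Longrightarrow> lev x < lev w \<or> lev y < lev w"
begin

abbreviation "right_children \<equiv> later_children E lev pos"
abbreviation "right_siblings \<equiv> later_siblings E lev pos"
abbreviation "pk \<equiv> peak E lev pos"
abbreviation "right_start \<equiv> side_start E lev pos pk"
abbreviation "child_color \<equiv> down_color E lev pos pk"

lemma finite_V: "finite V" using simple by (simp add: simple_graph_def)

lemma edge_in: "{x, y} \<in> E \<Longrightarrow> x \<in> V \<and> y \<in> V \<and> x \<noteq> y"
  using simple by (fastforce simp: simple_graph_def)

lemma edge_pos: "{x, y} \<in> E \<Longrightarrow> pos x < pos y \<or> pos y < pos x"
  using edge_in inj_pos by (metis inj_onD linorder_neqE)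

lemma mirror: "layered V E lev (\<lambda>x. - pos x) r"
proof
  show "inj_on (\<lambda>x. - pos x) V" using inj_pos by (auto simp: inj_on_def)
  fix a b c d
  assume *: "{a, c} \<in> E" "{b, d} \<in> E" "- pos a < - pos b" "- pos b < - pos c" "- pos c < - pos d"
  show False using noncrossing[of d b c a] * by (simp add: insert_commute)
next
  fix x y w
  assume *: "{x, y} \<in> E" "w \<in> V" "- pos x < - pos w" "- pos w < - pos y"
  show "lev x < lev w \<or> lev y < lev w" using cover[of y x w] * by (auto simp: insert_commute)
qed (use simple lev_edge lev_0 has_parent in auto)

lemma finite_right_children [simp]: "finite (right_children v)"
  by (rule finite_subset[OF _ finite_V]) (use edge_in in \<open>auto simp: later_children_def\<close>)

lemma finite_right_siblings [simp]: "finite (right_siblings v)"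
  by (rule finite_subset[OF _ finite_V]) (use edge_in in \<open>auto simp: later_siblings_def\<close>)

lemma finite_parents [simp]: "finite (parents E lev v)"
  by (rule finite_subset[OF _ finite_V]) (use edge_in in \<open>auto simp: parents_def\<close>)

lemma parents_nonempty: "v \<in> V \<Longrightarrow> lev v = Suc l \<Longrightarrow> parents E lev v \<noteq> {}"
  using has_parent unfolding parents_def by fastforce

lemma side_start_cong:
  assumes "\<And>x. lev x = lev v \<Longrightarrow> f x = g x"
  shows "side_start E lev pos' f v = side_start E lev pos' g v"
proof -
  have "f ` insert v (later_siblings E lev pos' v) = g ` insert v (later_siblings E lev pos' v)"
    by (rule image_cong) (use assms in \<open>auto simp: later_siblings_def\<close>)
  thus ?thesis by (simp only: side_start_def)
qed

lemma down_color_cong: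
  assumes "\<And>x. lev x = lev v \<Longrightarrow> f x = g x"
  shows "down_color E lev pos' f v z = down_color E lev pos' g v z"
proof -
  have "side_start E lev q f v = side_start E lev q g v" for q by (rule side_start_cong[OF assms])
  thus ?thesis by (simp only: down_color_def side_color_def)
qed

lemma peak_rec:
  assumes "lev z = Suc l"
  shows "pk z = Max ((\<lambda>p. child_color p z) ` parents E lev z)"
proof -
  have "down_color E lev pos (peak_at E lev pos l) p z = child_color p z" if "p \<in> parents E lev z" for p
    by (rule down_color_cong) (use that assms in \<open>auto simp: parents_def peak_def\<close>)
  hence "(\<lambda>p. down_color E lev pos (peak_at E lev pos l) p z) ` parents E lev z
    = (\<lambda>p. child_color p z) ` parents E lev z" by (intro image_cong) auto
  thus ?thesis using assms by (simp add: peak_def)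
qed

lemma down_color_mirror:
  assumes "{v, z} \<in> E"
  shows "down_color E lev (\<lambda>x. - pos x) f v z = down_color E lev pos f v z"
  using edge_pos[OF assms] by (auto simp: down_color_def)

lemma peak_at_mirror: "peak_at E lev (\<lambda>x. - pos x) l = peak_at E lev pos l"
proof (induction l)
  case (Suc l)
  have "(\<lambda>p. down_color E lev (\<lambda>x. - pos x) f p z) ` parents E lev z
      = (\<lambda>p. down_color E lev pos f p z) ` parents E lev z" for f z
    by (intro image_cong) (auto simp: parents_def down_color_mirror)
  thus ?case by (simp only: peak_at.simps Suc)
qed simp

lemma peak_mirror: "peak E lev (\<lambda>x. - pos x) = pk"
  by (simp add: peak_def peak_at_mirror fun_eq_iff)

text \<open>
Two vertices of the same level that face each other: nothing of their level or above lies
between them. Neighbors within a level form an open gap, and so do the two parents of a vertex.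
\<close>
definition open_gap :: "'a \<Rightarrow> 'a \<Rightarrow> bool" where
  "open_gap x y \<longleftrightarrow> x \<in> V \<and> y \<in> V \<and> lev x = lev y \<and> pos x < pos y \<and>
     (\<forall>w\<in>V. pos x < pos w \<and> pos w < pos y \<longrightarrow> lev x < lev w)"

lemma edge_open_gap: "{x, y} \<in> E \<Longrightarrow> lev x = lev y \<Longrightarrow> pos x < pos y \<Longrightarrow> open_gap x y"
  unfolding open_gap_def using cover edge_in by metis

lemma siblings_gap:
  assumes "open_gap x y"
  shows "right_siblings x = (if {x, y} \<in> E then {y} else {})"
proof -
  have "w = y" if "w \<in> right_siblings x" for w
  proof -
    have w: "{x, w} \<in> E" "lev w = lev x" "pos x < pos w" "w \<in> V" using that edge_in by (auto simp: later_siblings_def)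
    have "\<not> pos w < pos y" using assms w unfolding open_gap_def by fastforce
    moreover have "\<not> pos y < pos w" using cover[OF w(1), of y] assms w unfolding open_gap_def by auto
    ultimately show ?thesis using inj_pos w assms unfolding open_gap_def by (metis inj_onD linorder_neqE)
  qed
  thus ?thesis using assms by (auto simp: later_siblings_def open_gap_def)
qed

lemma start_gap:
  assumes "open_gap x y"
  shows "right_start x = Suc (if {x, y} \<in> E then max (pk x) (pk y) else pk x)"
  unfolding side_start_def siblings_gap[OF assms] by auto

end

lemma (in layered) open_gap_mirror: "layered.open_gap V lev (\<lambda>x. - pos x) y x \<longleftrightarrow> open_gap x y"
proof -
  interpret m: layered V E lev "\<lambda>x. - pos x" r by (rule mirror)
  show ?thesis unfolding m.open_gap_def open_gap_def by (auto)
qed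

context layered begin

abbreviation "left_start \<equiv> side_start E lev (\<lambda>x. - pos x) pk"
abbreviation "left_children \<equiv> later_children E lev (\<lambda>x. - pos x)"
abbreviation "left_siblings \<equiv> later_siblings E lev (\<lambda>x. - pos x)"

lemma siblings_gap_left: "open_gap x y \<Longrightarrow> left_siblings y = (if {x, y} \<in> E then {x} else {})"
  using layered.siblings_gap[OF mirror] open_gap_mirror by (simp add: insert_commute)

lemma start_gap_left:
  assumes "open_gap x y"
  shows "left_start y = Suc (if {x, y} \<in> E then max (pk x) (pk y) else pk y)"
  unfolding side_start_def siblings_gap_left[OF assms] by (auto simp: max.commute)

definition near :: "nat \<Rightarrow> nat \<Rightarrow> bool" where "near m n \<longleftrightarrow> m \<le> Suc n \<and> n \<le> Suc m"

text \<open>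
An edge across the gap makes the two starting colors equal, because they are both the
successor of the color of that edge. Without it they are the successors of the peaks.
\<close>
lemma starts_near:
  "open_gap x y \<Longrightarrow> near (pk x) (pk y) \<Longrightarrow> near (right_start x) (left_start y)"
  by (auto simp: start_gap start_gap_left near_def)

lemma parent_between:
  assumes "{p, z} \<in> E" "lev z = Suc (lev p)" "w \<in> V" "pos p < pos w" "pos w < pos z"
  shows "lev p < lev w"
  using cover[OF assms(1,3,4,5)] assms(2) by auto

lemma parent_between_right:
  assumes "{z, q} \<in> E" "lev z = Suc (lev q)" "w \<in> V" "pos z < pos w" "pos w < pos q"
  shows "lev q < lev w"
  using cover[OF assms(1,3,4,5)] assms(2) by auto

text \<open>
The parents of a vertex, or of two facing vertices without common parent, face
each other themselves. No other child of \<open>u\<close> can lie behind \<open>x\<close>, as its edge to \<open>u\<close> would cross \<open>{y, v}\<close> or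
cover \<open>v\<close>; so \<open>x\<close> is the child at which the colors of \<open>u\<close> start, and likewise for \<open>y\<close> and \<open>v\<close>.
\<close>
lemma child_gap:
  assumes u: "{u, x} \<in> E" "lev x = Suc (lev u)" "pos u < pos x"
    and v: "{y, v} \<in> E" "lev y = Suc (lev v)" "pos y < pos v"
    and xy: "x = y \<or> open_gap x y \<and> {u, y} \<notin> E \<and> {x, v} \<notin> E"
  shows "open_gap u v" "right_children u \<inter> {w. pos x < pos w} = {}" "left_children v \<inter> {w. pos w < pos y} = {}"
proof -
  have l: "lev u = lev v" using u v xy by (auto simp: open_gap_def)
  have V: "u \<in> V" "v \<in> V" "x \<in> V" "y \<in> V" using edge_in u v by blast+
  have xy': "pos x \<le> pos y" using xy by (auto simp: open_gap_def)
  show gap: "open_gap u v" unfolding open_gap_def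
  proof (intro conjI ballI impI)
    fix w assume w: "w \<in> V" "pos u < pos w \<and> pos w < pos v"
    consider "pos w < pos x" | "pos w = pos x" | "pos x < pos w" "pos w < pos y" | "pos w = pos y" | "pos y < pos w"
      by linarith
    thus "lev u < lev w"
    proof cases
      case 1 thus ?thesis using parent_between[OF u(1,2) w(1)] w by auto
    next
      case 2 thus ?thesis using inj_pos V w u by (metis inj_onD lessI)
    next
      case 3 thus ?thesis using xy w u unfolding open_gap_def by fastforce
    next
      case 4 thus ?thesis using inj_pos V w v l by (metis inj_onD lessI)
    next
      case 5 thus ?thesis using parent_between_right[OF v(1,2) w(1)] w l by auto
    qed
  qed (use V l u v xy' in auto)
  show "right_children u \<inter> {w. pos x < pos w} = {}"
  proof -
    have False if w: "w \<in> right_children u" "pos x < pos w" for w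
    proof -
      have w': "{u, w} \<in> E" "lev w = Suc (lev u)" "w \<in> V" using w edge_in by (auto simp: later_children_def)
      have "\<not> pos v < pos w" using cover[OF w'(1), of v] V w' gap unfolding open_gap_def by auto
      moreover have "w \<noteq> v" using w' l by auto
      ultimately have wv: "pos w < pos v" using inj_pos V w' by (metis inj_onD linorder_neqE)
      have "\<not> pos w < pos y" using xy w w' u unfolding open_gap_def by fastforce
      moreover have "\<not> pos y < pos w" using noncrossing[OF w'(1) v(1)] xy' u wv by auto
      ultimately have "w = y" using inj_pos V w' by (metis inj_onD linorder_neqE)
      thus False using w' w xy by auto
    qed
    thus ?thesis by auto
  qed
  show "left_children v \<inter> {w. pos w < pos y} = {}"
  proof -
    have False if w: "w \<in> left_children v" "pos w < pos y" for w
    proof -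
      have w': "{w, v} \<in> E" "lev w = Suc (lev v)" "w \<in> V"
        using w edge_in[of v w] by (auto simp: later_children_def insert_commute)
      have "\<not> pos w < pos u" using cover[OF w'(1), of u] V w' gap unfolding open_gap_def by auto
      moreover have "w \<noteq> u" using w' l by auto
      ultimately have wu: "pos u < pos w" using inj_pos V w' by (metis inj_onD linorder_neqE)
      have "\<not> pos x < pos w" using xy w w' v unfolding open_gap_def by fastforce
      moreover have "\<not> pos w < pos x" using noncrossing[OF u(1) w'(1)] xy' v wu by auto
      ultimately have "w = x" using inj_pos V w' by (metis inj_onD linorder_neqE)
      thus False using w' w xy by auto
    qed
    thus ?thesis by auto
  qed
qed

definition left_parent :: "'a \<Rightarrow> 'a \<Rightarrow> bool" where
  "left_parent u z \<longleftrightarrow> {u, z} \<in> E \<and> lev z = Suc (lev u) \<and> pos u < pos z"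

definition right_parent :: "'a \<Rightarrow> 'a \<Rightarrow> bool" where
  "right_parent v z \<longleftrightarrow> {v, z} \<in> E \<and> lev z = Suc (lev v) \<and> pos z < pos v"

lemma child_color_left: "left_parent u z \<Longrightarrow> child_color u z = right_start u + card {y \<in> right_children u. pos z < pos y}"
  by (simp add: down_color_def left_parent_def side_color_def)

lemma child_color_right: "right_parent v z \<Longrightarrow> child_color v z = left_start v + card {y \<in> left_children v. pos y < pos z}"
  by (simp add: down_color_def right_parent_def side_color_def)

lemma in_parents_iff: "p \<in> parents E lev z \<longleftrightarrow> left_parent p z \<or> right_parent p z"
  using edge_pos unfolding parents_def left_parent_def right_parent_def by blast

lemma left_parent_unique: "left_parent u z \<Longrightarrow> left_parent u' z \<Longrightarrow> u = u'"
proof -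
  assume *: "left_parent u z" "left_parent u' z"
  hence V: "u \<in> V" "u' \<in> V" using edge_in unfolding left_parent_def by blast+
  have "\<not> pos u < pos u'" "\<not> pos u' < pos u"
    using * V parent_between[of u z u'] parent_between[of u' z u] unfolding left_parent_def by auto
  thus ?thesis using V inj_pos by (metis inj_onD linorder_neqE)
qed

lemma right_parent_unique: "right_parent u z \<Longrightarrow> right_parent u' z \<Longrightarrow> u = u'"
proof -
  assume *: "right_parent u z" "right_parent u' z"
  hence e: "{z, u} \<in> E" "{z, u'} \<in> E" by (auto simp: right_parent_def insert_commute)
  hence V: "u \<in> V" "u' \<in> V" using edge_in by blast+
  have "\<not> pos u < pos u'" "\<not> pos u' < pos u"
    using * e V parent_between_right[of z u u'] parent_between_right[of z u' u]
    unfolding right_parent_def by auto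
  thus ?thesis using V inj_pos by (metis inj_onD linorder_neqE)
qed

lemma peak_cases:
  assumes "z \<in> V" "lev z = Suc l"
  obtains (left) u where "left_parent u z" "\<And>v. \<not> right_parent v z" "pk z = child_color u z"
  | (right) v where "right_parent v z" "\<And>u. \<not> left_parent u z" "pk z = child_color v z"
  | (both) u v where "left_parent u z" "right_parent v z" "pk z = max (child_color u z) (child_color v z)"
proof (cases "\<exists>u. left_parent u z")
  case True
  then obtain u where u: "left_parent u z" by blast
  show ?thesis
  proof (cases "\<exists>v. right_parent v z")
    case True
    then obtain v where v: "right_parent v z" by blast
    have "parents E lev z = {u, v}"
      using u v left_parent_unique right_parent_unique in_parents_iff by blast
    thus thesis using both[OF u v] peak_rec[OF assms(2)] by simp
  next
    case False
    hence "parents E lev z = {u}" using u left_parent_unique in_parents_iff by blast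
    thus thesis using left[OF u] False peak_rec[OF assms(2)] by simp
  qed
next
  case False
  then obtain v where v: "right_parent v z" using parents_nonempty[OF assms] in_parents_iff by blast
  hence "parents E lev z = {v}" using False right_parent_unique in_parents_iff by blast
  thus thesis using right[OF v] False peak_rec[OF assms(2)] by simp
qed

lemma gap_parents:
  assumes u: "left_parent u x" and v: "right_parent v y"
    and xy: "x = y \<or> open_gap x y \<and> \<not> left_parent u y \<and> \<not> right_parent v x"
  shows "open_gap u v" "child_color u x = right_start u" "child_color v y = left_start v"
proof -
  have *: "x = y \<or> open_gap x y \<and> {u, y} \<notin> E \<and> {x, v} \<notin> E"
    using xy u v unfolding left_parent_def right_parent_def open_gap_def by (auto simp: insert_commute)
  note cg = child_gap[of u x y v, OF _ _ _ _ _ _ *]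
  show "open_gap u v" using cg(1) u v by (simp add: left_parent_def right_parent_def insert_commute)
  have "right_children u \<inter> {w. pos x < pos w} = {}"
    using cg(2) u v by (simp add: left_parent_def right_parent_def insert_commute)
  hence "{w \<in> right_children u. pos x < pos w} = {}" by blast
  thus "child_color u x = right_start u" unfolding child_color_left[OF u] by simp
  have "left_children v \<inter> {w. pos w < pos y} = {}"
    using cg(3) u v by (simp add: left_parent_def right_parent_def insert_commute)
  hence "{w \<in> left_children v. pos w < pos y} = {}" by blast
  thus "child_color v y = left_start v" unfolding child_color_right[OF v] by (metis card.empty add_0_right)
qed

text \<open>
If \<open>y\<close> hangs on \<open>u\<close> from the left, then so does \<open>x\<close>, and \<open>x\<close> has no right parent since the
edge to it would cross \<open>{u, y}\<close>. Thus \<open>x\<close> is the next child of \<open>u\<close> after \<open>y\<close> in the order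
of the colors.
\<close>
lemma step_left:
  assumes u: "left_parent u y" and xy: "open_gap x y"
  shows "left_parent u x" "\<And>v. \<not> right_parent v x" "pk x = Suc (child_color u y)"
proof -
  have V: "x \<in> V" "y \<in> V" "u \<in> V" and lx: "lev x = Suc (lev u)"
    using u xy edge_in unfolding left_parent_def open_gap_def by auto
  have "pos u \<noteq> pos x" using V lx inj_pos by (metis inj_onD n_not_Suc_n)
  moreover have "\<not> pos x < pos u" using xy u V unfolding left_parent_def open_gap_def by fastforce
  ultimately have ux: "pos u < pos x" by linarith
  show nr: "\<not> right_parent v x" for v
  proof
    assume v: "right_parent v x"
    hence vV: "v \<in> V" using edge_in unfolding right_parent_def by blast
    have "lev v < lev x" using v unfolding right_parent_def by simp
    hence "\<not> pos v < pos y" "v \<noteq> y" using v xy vV unfolding right_parent_def open_gap_def by fastforce+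
    hence "pos y < pos v" using inj_pos V vV by (metis inj_onD linorder_neqE)
    moreover have "{u, y} \<in> E" "{x, v} \<in> E" using u v by (auto simp: left_parent_def right_parent_def insert_commute)
    ultimately show False using noncrossing[of u y x v] ux xy unfolding open_gap_def by blast
  qed
  show ux': "left_parent u x"
  proof (cases rule: peak_cases[OF V(1) lx])
    case (1 u')
    have u'V: "u' \<in> V" using 1 edge_in unfolding left_parent_def by blast
    have e: "{u', x} \<in> E" "lev x = Suc (lev u')" "pos u' < pos x" using 1 by (auto simp: left_parent_def)
    have e': "{u, y} \<in> E" "lev y = Suc (lev u)" "pos x < pos y" "lev u' = lev u"
      using u xy lx e by (auto simp: left_parent_def open_gap_def)
    have "\<not> pos u < pos u'" using parent_between[OF e'(1,2) u'V] e e' by auto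
    moreover have "\<not> pos u' < pos u" using parent_between[OF e(1,2) V(3)] e e' ux by auto
    ultimately have "u = u'" using inj_pos V u'V by (metis inj_onD linorder_neqE)
    thus ?thesis using 1 by simp
  qed (use nr in blast)+
  have "pk x = child_color u x"
    by (cases rule: peak_cases[OF V(1) lx]) (use nr ux' left_parent_unique in metis)+
  moreover have "{w \<in> right_children u. pos x < pos w} = insert y {w \<in> right_children u. pos y < pos w}"
  proof -
    have "y \<in> right_children u" using u by (simp add: left_parent_def later_children_def)
    moreover have "w = y \<or> pos y < pos w" if "w \<in> right_children u" "pos x < pos w" for w
    proof -
      have w: "w \<in> V" "lev w = lev x" using that edge_in lx by (auto simp: later_children_def)
      hence "\<not> pos w < pos y" using xy that unfolding open_gap_def by fastforce
      thus ?thesis using inj_pos V w by (metis inj_onD linorder_neqE)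
    qed
    ultimately show ?thesis using xy unfolding open_gap_def by auto
  qed
  hence "card {w \<in> right_children u. pos x < pos w} = Suc (card {w \<in> right_children u. pos y < pos w})" by simp
  ultimately show "pk x = Suc (child_color u y)" unfolding child_color_left[OF u] child_color_left[OF ux'] by simp
qed

end

lemma (in layered) step_right:
  assumes v: "right_parent v x" and xy: "open_gap x y"
  shows "right_parent v y" "\<And>u. \<not> left_parent u y" "pk y = Suc (child_color v x)"
proof -
  interpret m: layered V E lev "\<lambda>x. - pos x" r by (rule mirror)
  have lr: "m.left_parent a b \<longleftrightarrow> right_parent a b" "m.right_parent a b \<longleftrightarrow> left_parent a b" for a b
    by (auto simp: m.left_parent_def m.right_parent_def left_parent_def right_parent_def)
  have e: "{v, x} \<in> E" using v by (simp add: right_parent_def)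
  have g: "m.open_gap y x" using xy open_gap_mirror by blast
  have v': "m.left_parent v x" using v lr by blast
  show "right_parent v y" "\<And>u. \<not> left_parent u y" using m.step_left(1,2)[OF v' g] lr by blast+
  show "pk y = Suc (child_color v x)" using m.step_left(3)[OF v' g] by (simp add: peak_mirror down_color_mirror[OF e])
qed

context layered begin

text \<open>
The invariant of the coloring. If facing vertices have a common parent, their peaks are
consecutive colors at that parent, up to the second parent that one of them may have. If not, their
peaks are the starting colors of two parents that face each other one level higher up.
\<close>
lemma gap_near: "open_gap x y \<Longrightarrow> near (pk x) (pk y)"
proof (induction "lev x" arbitrary: x y)
  case 0
  hence "x = y" using lev_0 unfolding open_gap_def by metis
  thus ?case using 0 by (simp add: open_gap_def)
next
  case (Suc l)
  have V: "x \<in> V" "y \<in> V" "lev x = Suc l" "lev y = Suc l" using Suc unfolding open_gap_def by auto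
  have IH: "near (right_start u) (left_start v)" if "open_gap u v" "lev u = l" for u v
    using starts_near[OF that(1)] Suc.hyps(1)[of u v] that by simp
  have both: "near (child_color u z) (child_color v z)"
    if "left_parent u z" "right_parent v z" "lev z = Suc l" for u v z
    using gap_parents[OF that(1,2)] IH that by (simp add: left_parent_def)
  show ?case
  proof (cases "\<exists>u. left_parent u y")
    case True
    then obtain u where u: "left_parent u y" by blast
    have "near (Suc (child_color u y)) (pk y)"
    proof (cases rule: peak_cases[OF V(2,4)])
      case (1 u')
      moreover have "u' = u" using left_parent_unique u 1 by blast
      ultimately show ?thesis by (simp add: near_def)
    next
      case (2 v) thus ?thesis using u by blast
    next
      case (3 u' v)
      moreover have "u' = u" using left_parent_unique u 3 by blast
      ultimately show ?thesis using both[of u y v] V by (auto simp: near_def)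
    qed
    thus ?thesis using step_left(3)[OF u Suc(3)] by simp
  next
    case nl: False
    show ?thesis
    proof (cases "\<exists>v. right_parent v x")
      case True
      then obtain v where v: "right_parent v x" by blast
      have "near (pk x) (Suc (child_color v x))"
      proof (cases rule: peak_cases[OF V(1,3)])
        case (1 u') thus ?thesis using v by blast
      next
        case (2 v')
        moreover have "v' = v" using right_parent_unique v 2 by blast
        ultimately show ?thesis by (simp add: near_def)
      next
        case (3 u v')
        moreover have "v' = v" using right_parent_unique v 3 by blast
        ultimately show ?thesis using both[of u x v] V by (auto simp: near_def)
      qed
      thus ?thesis using step_right(3)[OF v Suc(3)] by simp
    next
      case nr: False
      obtain u where u: "left_parent u x" "pk x = child_color u x"
        by (cases rule: peak_cases[OF V(1,3)]) (use nr in blast)+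
      obtain v where v: "right_parent v y" "pk y = child_color v y"
        by (cases rule: peak_cases[OF V(2,4)]) (use nl in blast)+
      have *: "x = y \<or> open_gap x y \<and> \<not> left_parent u y \<and> \<not> right_parent v x"
        using nl nr Suc by blast
      show ?thesis using gap_parents[OF u(1) v(1) *] IH[of u v] u v V by (simp add: left_parent_def)
    qed
  qed
qed

lemma parents_near:
  assumes "left_parent u z" "right_parent v z"
  shows "near (child_color u z) (child_color v z)"
  using gap_parents[OF assms] starts_near[of u v] gap_near[of u v] by simp

text \<open>
Edges are sets, so the upper end has to be recovered from the levels of the two ends.
\<close>
definition edge_color :: "'a set \<Rightarrow> nat" where
  "edge_color e = (THE c. \<exists>v z. e = {v, z} \<and>
     (lev z = Suc (lev v) \<and> c = child_color v z \<or> lev z = lev v \<and> c = max (pk v) (pk z)))"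

lemma edge_color_down:
  assumes "lev z = Suc (lev v)"
  shows "edge_color {v, z} = child_color v z"
  unfolding edge_color_def
  by (rule the_equality) (use assms in \<open>auto simp: doubleton_eq_iff\<close>)

lemma edge_color_same:
  assumes "lev z = lev v"
  shows "edge_color {v, z} = max (pk v) (pk z)"
  unfolding edge_color_def
  by (rule the_equality) (use assms in \<open>auto simp: doubleton_eq_iff max.commute\<close>)

definition later_nbrs :: "'a \<Rightarrow> 'a set" where
  "later_nbrs z = {w. {z, w} \<in> E \<and> pos z < pos w}"

lemma later_nbrs_eq: "later_nbrs z = {v. right_parent v z} \<union> (right_siblings z \<union> right_children z)"
proof -
  have "lev w = Suc (lev z) \<or> lev w = lev z \<or> lev z = Suc (lev w)" if "{z, w} \<in> E" for w
    using lev_edge[of z w] lev_edge[of w z] that by (auto simp: insert_commute)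
  thus ?thesis
    unfolding later_nbrs_def right_parent_def later_siblings_def later_children_def
    by (auto simp: insert_commute)
qed

lemma sibling_gap: "y \<in> right_siblings z \<Longrightarrow> open_gap z y"
  by (auto simp: later_siblings_def intro: edge_open_gap)

lemma later_siblings_eq: "y \<in> right_siblings z \<Longrightarrow> right_siblings z = {y}"
  using siblings_gap[OF sibling_gap, of y z] by (cases "{z, y} \<in> E") auto

lemma later_children_colors:
  shows "(\<lambda>w. edge_color {z, w}) ` right_children z = {right_start z..<right_start z + card (right_children z)}"
    and "inj_on (\<lambda>w. edge_color {z, w}) (right_children z)"
proof -
  have c: "edge_color {z, w} = right_start z + card {y \<in> right_children z. pos w < pos y}" if "w \<in> right_children z" for w
  proof -
    have "left_parent z w" using that by (simp add: left_parent_def later_children_def)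
    thus ?thesis using edge_color_down[of w z] child_color_left by (simp add: left_parent_def)
  qed
  have "inj_on pos (right_children z)"
    by (rule inj_on_subset[OF inj_pos]) (use edge_in in \<open>auto simp: later_children_def\<close>)
  from bij_betw_rank[OF finite_right_children this]
  have b: "inj_on (\<lambda>w. card {y \<in> right_children z. pos w < pos y}) (right_children z)"
      "(\<lambda>w. card {y \<in> right_children z. pos w < pos y}) ` right_children z = {0..<card (right_children z)}"
    by (auto simp: bij_betw_def)
  show "inj_on (\<lambda>w. edge_color {z, w}) (right_children z)"
    using b(1) c by (auto simp: inj_on_def)
  have "(\<lambda>w. edge_color {z, w}) ` right_children z = (+) (right_start z) ` (\<lambda>w. card {y \<in> right_children z. pos w < pos y}) ` right_children z"
    unfolding image_image by (rule image_cong[OF refl c])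
  also have "\<dots> = {right_start z..<right_start z + card (right_children z)}"
    unfolding b(2) by (simp add: image_add_atLeastLessThan add.commute)
  finally show "(\<lambda>w. edge_color {z, w}) ` right_children z = {right_start z..<right_start z + card (right_children z)}" .
qed

text \<open>
The colors on the later side of \<open>z\<close>, apart from that of a parent, continue the peak of \<open>z\<close>
without a gap. They repeat neither each other nor the color of the parent: if there are a
parent \<open>v\<close> and a sibling \<open>y\<close> on that side, then the peak of \<open>y\<close> exceeds the color of the edge to \<open>v\<close>
by \<open>step_right\<close>.
\<close>
lemma later_colors:
  shows "\<exists>t \<ge> pk z. insert (pk z) ((\<lambda>w. edge_color {z, w}) ` (right_siblings z \<union> right_children z)) = {pk z..t}"
    and "inj_on (\<lambda>w. edge_color {z, w}) (later_nbrs z)"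
    and "right_siblings z = {} \<Longrightarrow> w \<in> right_children z \<Longrightarrow> pk z < edge_color {z, w}"
proof -
  let ?g = "\<lambda>w. edge_color {z, w}"
  have up: "?g v = child_color v z" if "right_parent v z" for v
    using edge_color_down[of z v] that by (simp add: right_parent_def insert_commute)
  have upA: "child_color v z \<le> pk z" if "right_parent v z" for v
  proof -
    have "child_color v z \<in> (\<lambda>p. child_color p z) ` parents E lev z" using that in_parents_iff by blast
    hence "child_color v z \<le> Max ((\<lambda>p. child_color p z) ` parents E lev z)" by (intro Max_ge) auto
    thus ?thesis using peak_rec[of z "lev v"] that by (simp add: right_parent_def)
  qed
  have up1: "v = v'" if "right_parent v z" "right_parent v' z" for v v'
    using that right_parent_unique by blast
  have ch: "right_start z \<le> ?g w" if "w \<in> right_children z" for w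
    using later_children_colors(1)[of z] that by auto
  have "(\<exists>t \<ge> pk z. insert (pk z) (?g ` (right_siblings z \<union> right_children z)) = {pk z..t}) \<and> inj_on ?g (later_nbrs z) \<and>
      (right_siblings z = {} \<longrightarrow> w \<in> right_children z \<longrightarrow> pk z < ?g w)"
  proof (cases "right_siblings z = {}")
    case True
    hence st: "right_start z = Suc (pk z)" by (simp add: side_start_def)
    have 1: "insert (pk z) (?g ` (right_siblings z \<union> right_children z)) = {pk z..pk z + card (right_children z)}"
      unfolding True Un_empty_left later_children_colors(1) st by auto
    have 2: "inj_on ?g (later_nbrs z)"
      unfolding later_nbrs_eq True Un_empty_left inj_on_Un
    proof (intro conjI ballI impI)
      show "inj_on ?g {v. right_parent v z}" using up1 by (auto intro: inj_onI)
      show "inj_on ?g (right_children z)" by (rule later_children_colors(2))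
      have "?g v < ?g w" if "right_parent v z" "w \<in> right_children z" for v w
        using up[OF that(1)] upA[OF that(1)] ch[OF that(2)] st by simp
      thus "?g ` ({v. right_parent v z} - right_children z) \<inter> ?g ` (right_children z - {v. right_parent v z}) = {}"
        by fastforce
    qed
    have "pk z < ?g w" if "w \<in> right_children z" using ch[OF that] st by simp
    thus ?thesis using 1 2 le_add1[of "pk z" "card (right_children z)"] by blast
  next
    case False
    then obtain y where y: "y \<in> right_siblings z" by blast
    have right_siblings: "right_siblings z = {y}" by (rule later_siblings_eq[OF y])
    have gap: "open_gap z y" by (rule sibling_gap[OF y])
    have gy: "?g y = max (pk z) (pk y)" using edge_color_same gap unfolding open_gap_def by simp
    have st: "right_start z = Suc (?g y)" unfolding side_start_def right_siblings gy by (simp add: max.commute)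
    have gy': "?g y = pk z \<or> ?g y = Suc (pk z)" using gap_near[OF gap] unfolding gy near_def by linarith
    have 1: "insert (pk z) (?g ` (right_siblings z \<union> right_children z)) = {pk z..?g y + card (right_children z)}"
      unfolding right_siblings image_Un later_children_colors(1) st using gy' by auto
    have upy: "?g v < ?g y" if "right_parent v z" for v
      using step_right(3)[OF that gap] up[OF that] gy by simp
    have 2: "inj_on ?g (later_nbrs z)"
      unfolding later_nbrs_eq right_siblings inj_on_Un
    proof (intro conjI ballI impI)
      show "inj_on ?g {v. right_parent v z}" using up1 by (auto intro: inj_onI)
      show "inj_on ?g (right_children z)" by (rule later_children_colors(2))
      have yw: "?g y < ?g w" if "w \<in> right_children z" for w
        using ch[OF that] st by simp
      thus "?g ` ({y} - right_children z) \<inter> ?g ` (right_children z - {y}) = {}" by fastforce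
      have "?g v < ?g w" if "right_parent v z" "w \<in> {y} \<union> right_children z" for v w
        using upy[OF that(1)] yw that(2) by fastforce
      thus "?g ` ({v. right_parent v z} - ({y} \<union> right_children z)) \<inter> ?g ` ({y} \<union> right_children z - {v. right_parent v z}) = {}"
        by fastforce
    qed auto
    have "pk z \<le> ?g y + card (right_children z)" using gy' by auto
    thus ?thesis using 1 2 False by blast
  qed
  thus "\<exists>t \<ge> pk z. insert (pk z) (?g ` (right_siblings z \<union> right_children z)) = {pk z..t}"
      "inj_on ?g (later_nbrs z)" "right_siblings z = {} \<Longrightarrow> w \<in> right_children z \<Longrightarrow> pk z < ?g w" by blast+
qed

end

context layered begin

lemma earlier_colors:
  shows "\<exists>t \<ge> pk z. insert (pk z) ((\<lambda>w. edge_color {z, w}) ` (left_siblings z \<union> left_children z)) = {pk z..t}"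
    and "inj_on (\<lambda>w. edge_color {z, w}) {w. {z, w} \<in> E \<and> pos w < pos z}"
    and "left_siblings z = {} \<Longrightarrow> w \<in> left_children z \<Longrightarrow> pk z < edge_color {z, w}"
proof -
  interpret m: layered V E lev "\<lambda>x. - pos x" r by (rule mirror)
  have ec: "m.edge_color {z, w} = edge_color {z, w}" if "{z, w} \<in> E" for w
  proof -
    note e0 = that
    have e: "{w, z} \<in> E" using e0 by (simp add: insert_commute)
    consider "lev w = Suc (lev z)" | "lev w = lev z" | "lev z = Suc (lev w)"
      using lev_edge[OF e0] lev_edge[OF e] by linarith
    thus ?thesis
    proof cases
      case 1 thus ?thesis
        by (simp add: edge_color_down m.edge_color_down peak_mirror down_color_mirror[OF that])
    next
      case 2 thus ?thesis by (simp add: edge_color_same m.edge_color_same peak_mirror)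
    next
      case 3 thus ?thesis unfolding insert_commute[of z w]
        by (simp add: edge_color_down m.edge_color_down peak_mirror down_color_mirror[OF e])
    qed
  qed
  have im: "(\<lambda>w. m.edge_color {z, w}) ` (left_siblings z \<union> left_children z) = (\<lambda>w. edge_color {z, w}) ` (left_siblings z \<union> left_children z)"
    by (rule image_cong) (auto simp: later_siblings_def later_children_def intro!: ec)
  show "\<exists>t \<ge> pk z. insert (pk z) ((\<lambda>w. edge_color {z, w}) ` (left_siblings z \<union> left_children z)) = {pk z..t}"
    using m.later_colors(1)[of z] unfolding im by (simp add: peak_mirror)
  show "inj_on (\<lambda>w. edge_color {z, w}) {w. {z, w} \<in> E \<and> pos w < pos z}"
    using m.later_colors(2)[of z] ec unfolding m.later_nbrs_def by (simp add: inj_on_def)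
  show "left_siblings z = {} \<Longrightarrow> w \<in> left_children z \<Longrightarrow> pk z < edge_color {z, w}"
    using m.later_colors(3)[of z w] ec[of w] by (simp add: peak_mirror later_children_def)
qed

lemma nbrs_eq:
  "{w. {z, w} \<in> E} = {u. left_parent u z \<or> right_parent u z} \<union> (right_siblings z \<union> right_children z) \<union> (left_siblings z \<union> left_children z)"
proof -
  have "lev w = Suc (lev z) \<or> lev w = lev z \<or> lev z = Suc (lev w)" if "{z, w} \<in> E" for w
    using lev_edge[of z w] lev_edge[of w z] that by (auto simp: insert_commute)
  thus ?thesis
    unfolding left_parent_def right_parent_def later_siblings_def later_children_def
    using edge_pos by (auto simp: insert_commute)
qed

lemma incident_edges_eq: "incident_edges E z = (\<lambda>w. {z, w}) ` {w. {z, w} \<in> E}"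
proof -
  have "\<exists>w. e = {z, w}" if "e \<in> E" "z \<in> e" for e
    using simple that unfolding simple_graph_def by (metis card_2_iff insertE insert_commute singletonD)
  thus ?thesis unfolding incident_edges_def by auto
qed

text \<open>
The colors of the edges to the parents form an interval that ends at the peak, as those of
two parents differ by at most 1. The colors of each side continue from the peak. At the root there
is neither a parent nor a sibling, and both sides start just above the peak.
\<close>
lemma interval_at:
  assumes "z \<in> V"
  shows "\<exists>a b. edge_color ` incident_edges E z = {a..b}"
proof -
  let ?g = "\<lambda>w. edge_color {z, w}"
  let ?P = "{u. left_parent u z \<or> right_parent u z}"
  obtain s where s: "pk z \<le> s" "insert (pk z) (?g ` (right_siblings z \<union> right_children z)) = {pk z..s}" using later_colors(1) by blast
  obtain t where t: "pk z \<le> t" "insert (pk z) (?g ` (left_siblings z \<union> left_children z)) = {pk z..t}" using earlier_colors(1) by blast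
  have img: "edge_color ` incident_edges E z = ?g ` ?P \<union> ?g ` (right_siblings z \<union> right_children z) \<union> ?g ` (left_siblings z \<union> left_children z)"
    unfolding incident_edges_eq image_image nbrs_eq by (simp only: image_Un)
  show ?thesis
  proof (cases "lev z")
    case 0
    have P: "?P = {}" using 0 by (auto simp: left_parent_def right_parent_def)
    have "w = z" if "w \<in> V" "lev w = lev z" for w using lev_0 that assms 0 by metis
    hence right_siblings: "right_siblings z = {}" "left_siblings z = {}" using edge_in unfolding later_siblings_def by blast+
    have "pk z \<notin> ?g ` (right_siblings z \<union> right_children z)" "pk z \<notin> ?g ` (left_siblings z \<union> left_children z)"
      using later_colors(3)[OF right_siblings(1)] earlier_colors(3)[OF right_siblings(2)] right_siblings by (fastforce dest: less_imp_neq)+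
    hence "?g ` (right_siblings z \<union> right_children z) = {pk z..s} - {pk z}" "?g ` (left_siblings z \<union> left_children z) = {pk z..t} - {pk z}"
      unfolding s(2)[symmetric] t(2)[symmetric] by blast+
    hence "edge_color ` incident_edges E z = {Suc (pk z)..max s t}" unfolding img P by auto
    thus ?thesis by blast
  next
    case (Suc l)
    have up: "?g u = child_color u z" if "left_parent u z \<or> right_parent u z" for u
      using edge_color_down[of z u] that by (auto simp: right_parent_def left_parent_def insert_commute)
    have "\<exists>a \<le> pk z. ?g ` ?P = {a..pk z}"
    proof (cases rule: peak_cases[OF assms Suc])
      case (1 u)
      hence "?P = {u}" using left_parent_unique by blast
      thus ?thesis using 1 up by (intro exI[of _ "pk z"]) auto
    next
      case (2 u)
      hence "?P = {u}" using right_parent_unique by blast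
      thus ?thesis using 2 up by (intro exI[of _ "pk z"]) auto
    next
      case (3 u v)
      hence "?P = {u, v}" using left_parent_unique right_parent_unique by blast
      thus ?thesis using 3 up parents_near[OF 3(1,2)]
        by (intro exI[of _ "min (child_color u z) (child_color v z)"]) (auto simp: near_def)
    qed
    then obtain a where a: "a \<le> pk z" "?g ` ?P = {a..pk z}" by blast
    have "edge_color ` incident_edges E z = ?g ` ?P \<union> insert (pk z) (?g ` (right_siblings z \<union> right_children z)) \<union> insert (pk z) (?g ` (left_siblings z \<union> left_children z))"
      unfolding img using a by auto
    also have "\<dots> = {a..max s t}" unfolding a(2) s(2) t(2) using a(1) s(1) t(1) by auto
    finally show ?thesis by blast
  qed
qed

text \<open>
By \<open>later_colors\<close> and its mirror image, no color repeats on one side of \<open>z\<close>.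
\<close>
lemma multiplicity_at: "card {e \<in> incident_edges E z. edge_color e = i} \<le> 2"
proof -
  let ?g = "\<lambda>w. edge_color {z, w}"
  have card1: "finite {w \<in> X. ?g w = i} \<and> card {w \<in> X. ?g w = i} \<le> 1" if "inj_on ?g X" for X
  proof (cases "\<exists>w \<in> X. ?g w = i")
    case True
    then obtain w where "w \<in> X" "?g w = i" by blast
    hence "{w \<in> X. ?g w = i} = {w}" using that by (auto simp: inj_on_def)
    thus ?thesis by simp
  next
    case False
    hence "{w \<in> X. ?g w = i} = {}" by blast
    thus ?thesis by (metis card.empty finite.emptyI zero_le)
  qed
  let ?X = "{w \<in> later_nbrs z. ?g w = i}" and ?Y = "{w \<in> {w. {z, w} \<in> E \<and> pos w < pos z}. ?g w = i}"
  note c = card1[OF later_colors(2)] card1[OF earlier_colors(2)]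
  have "{e \<in> incident_edges E z. edge_color e = i} \<subseteq> (\<lambda>w. {z, w}) ` (?X \<union> ?Y)"
    unfolding incident_edges_eq later_nbrs_def using edge_pos by auto
  hence "card {e \<in> incident_edges E z. edge_color e = i} \<le> card (?X \<union> ?Y)"
    using c by (meson card_image_le card_mono finite_UnI finite_imageI le_trans)
  also have "\<dots> \<le> card ?X + card ?Y" by (rule card_Un_le)
  also have "\<dots> \<le> 2" using c by linarith
  finally show ?thesis .
qed

lemma two_improper: "k_improper_interval_coloring 2 V E edge_color"
  unfolding k_improper_interval_coloring_def improper_interval_coloring_def
  using interval_at multiplicity_at by blast

end

section \<open>Breadth-first layers\<close>

definition adj :: "'a set set \<Rightarrow> ('a \<times> 'a) set" where
  "adj E = {(x, y). {x, y} \<in> E}"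

definition distance :: "'a set set \<Rightarrow> 'a \<Rightarrow> 'a \<Rightarrow> nat" where
  "distance E r v = (LEAST n. (r, v) \<in> adj E ^^ n)"

lemma distance_relpow: "(r, v) \<in> (adj E)\<^sup>* \<Longrightarrow> (r, v) \<in> adj E ^^ distance E r v"
  unfolding distance_def rtrancl_power by (rule LeastI_ex)

lemma distance_le: "(r, v) \<in> adj E ^^ n \<Longrightarrow> distance E r v \<le> n"
  unfolding distance_def by (rule Least_le)

text \<open>
For \<open>cover\<close>, follow a shortest path from \<open>w\<close> to the root: its next vertex \<open>p\<close> cannot
leave the range of the edge \<open>{x, y}\<close> without crossing it, so \<open>p\<close> is an end of the edge or again
covered by it.
\<close>
lemma layered_distance:
  assumes simple: "simple_graph V E" and page: "one_page V E pos"
    and r: "r \<in> V" "\<And>v. v \<in> V \<Longrightarrow> pos r \<le> pos v"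
    and conn: "\<And>v. v \<in> V \<Longrightarrow> (r, v) \<in> (adj E)\<^sup>*"
  shows "layered V E (distance E r) pos r"
proof
  let ?d = "distance E r"
  have in_V: "x \<in> V \<and> y \<in> V" if "{x, y} \<in> E" for x y
    using simple that unfolding simple_graph_def by auto
  have inj: "inj_on pos V" and nc: "\<And>a b c d. {a, c} \<in> E \<Longrightarrow> {b, d} \<in> E \<Longrightarrow>
      pos a < pos b \<Longrightarrow> pos b < pos c \<Longrightarrow> pos c < pos d \<Longrightarrow> False"
    using page unfolding one_page_def by blast+
  show "simple_graph V E" "inj_on pos V" by (fact simple, fact inj)
  show "\<And>a b c d. {a, c} \<in> E \<Longrightarrow> {b, d} \<in> E \<Longrightarrow> pos a < pos b \<Longrightarrow> pos b < pos c \<Longrightarrow> pos c < pos d \<Longrightarrow> False"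
    by (fact nc)
  show zero: "v = r" if "v \<in> V" "?d v = 0" for v
    using distance_relpow[OF conn[OF that(1)]] that(2) by simp
  show step: "?d y \<le> Suc (?d x)" if e: "{x, y} \<in> E" for x y
  proof -
    have "(r, x) \<in> adj E ^^ ?d x" using conn in_V e distance_relpow by metis
    hence "(r, y) \<in> adj E ^^ Suc (?d x)" using e by (auto simp: adj_def)
    thus ?thesis by (rule distance_le)
  qed
  show parent: "\<exists>p. {p, v} \<in> E \<and> ?d p = l" if "v \<in> V" "?d v = Suc l" for v l
  proof -
    have "(r, v) \<in> adj E ^^ Suc l" using distance_relpow[OF conn[OF that(1)]] that(2) by simp
    then obtain p where p: "(r, p) \<in> adj E ^^ l" "{p, v} \<in> E" by (auto simp: adj_def)
    have "?d p \<le> l" using p(1) by (rule distance_le)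
    moreover have "Suc l \<le> Suc (?d p)" using step[OF p(2)] that(2) by simp
    ultimately show ?thesis using p(2) by auto
  qed
  show "?d x < ?d w \<or> ?d y < ?d w"
    if "{x, y} \<in> E" "w \<in> V" "pos x < pos w" "pos w < pos y" for x y w
    using that
  proof (induction "?d w" arbitrary: w)
    case 0
    hence "w = r" using zero by metis
    thus ?case using r(2)[of x] in_V[OF that(1)] 0 by simp
  next
    case (Suc l)
    obtain p where p: "{p, w} \<in> E" "?d p = l" using parent[OF Suc(4)] Suc(2) by metis
    have V: "p \<in> V" "x \<in> V" "y \<in> V" using in_V p that(1) by blast+
    have wp: "{w, p} \<in> E" using p by (simp add: insert_commute)
    have "\<not> pos p < pos x" using nc[OF p(1) that(1)] Suc by blast
    moreover have "\<not> pos y < pos p" using nc[OF that(1) wp] Suc by blast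
    ultimately consider "p = x" | "p = y" | "pos x < pos p" "pos p < pos y"
      using inj V by (metis inj_onD linorder_neqE)
    thus ?case
    proof cases
      case 3
      thus ?thesis using Suc.hyps(1)[of p] p V that(1) Suc.hyps(2) by auto
    qed (use p Suc.hyps(2) in auto)
  qed
qed

text \<open>
The component of the leftmost vertex is colored by layers, and the rest by induction.
\<close>
lemma one_page_two_improper:
  assumes "simple_graph V E" "one_page V E pos"
  shows "\<exists>c. k_improper_interval_coloring 2 V E c"
  using assms
proof (induction "card V" arbitrary: V E rule: less_induct)
  case less
  show ?case
  proof (cases "V = {}")
    case True
    thus ?thesis unfolding k_improper_interval_coloring_def improper_interval_coloring_def by simp
  next
    case False
    have fin: "finite V" using less by (simp add: simple_graph_def)
    obtain r where r: "r \<in> V" "\<And>v. v \<in> V \<Longrightarrow> pos r \<le> pos v"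
      using arg_min_if_finite[OF fin False, of pos] by (metis linorder_not_less)
    define K where "K = {v \<in> V. (r, v) \<in> (adj E)\<^sup>*}"
    show ?thesis
    proof (cases "K = V")
      case True
      have "layered V E (distance E r) pos r"
      proof (rule layered_distance[OF less(2,3) r])
        show "(r, v) \<in> (adj E)\<^sup>*" if "v \<in> V" for v using that True unfolding K_def by auto
      qed
      from layered.two_improper[OF this] show ?thesis
        by (rule exI[where x = "layered.edge_color E (distance E r) pos"])
    next
      case False
      have K: "r \<in> K" "K \<subseteq> V" using r by (auto simp: K_def)
      have split: "e \<subseteq> K \<or> e \<subseteq> V - K" if e: "e \<in> E" for e
      proof -
        obtain x y where xy: "e = {x, y}" "x \<in> V" "y \<in> V"
          using e less(2) unfolding simple_graph_def by (metis card_2_iff insert_subset)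
        have "(x, y) \<in> adj E" "(y, x) \<in> adj E" using e xy by (auto simp: adj_def insert_commute)
        hence "x \<in> K \<longleftrightarrow> y \<in> K" using xy unfolding K_def by (auto intro: rtrancl_into_rtrancl)
        thus ?thesis using xy by auto
      qed
      have "\<exists>c. k_improper_interval_coloring 2 W {e \<in> E. e \<subseteq> W} c" if "W \<subset> V" for W
      proof (rule less(1))
        show "card W < card V" using fin that by (rule psubset_card_mono)
        show "simple_graph W {e \<in> E. e \<subseteq> W}" using less(2) that by (intro simple_graph_induced) auto
        show "one_page W {e \<in> E. e \<subseteq> W} pos" by (rule one_page_subset[OF less(3)]) (use that in auto)
      qed
      then obtain c1 c2 where c1: "k_improper_interval_coloring 2 K {e \<in> E. e \<subseteq> K} c1"
        and c2: "k_improper_interval_coloring 2 (V - K) {e \<in> E. e \<subseteq> V - K} c2"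
      proof -
        assume sub: "\<And>W. W \<subset> V \<Longrightarrow> \<exists>c. k_improper_interval_coloring 2 W {e \<in> E. e \<subseteq> W} c"
        have "K \<subset> V" "V - K \<subset> V" using K False by auto
        from sub[OF this(1)] sub[OF this(2)] show thesis using that by (elim exE)
      qed
      define c where "c e = (if e \<subseteq> K then c1 e else c2 e)" for e
      have 1: "incident_edges E v = incident_edges {e \<in> E. e \<subseteq> K} v" "\<forall>e\<in>incident_edges E v. c e = c1 e"
        if "v \<in> K" for v
        using that split unfolding incident_edges_def c_def by auto
      have 2: "incident_edges E v = incident_edges {e \<in> E. e \<subseteq> V - K} v" "\<forall>e\<in>incident_edges E v. c e = c2 e"
        if "v \<in> V - K" for v
        using that split unfolding incident_edges_def c_def by auto
      have good: "(\<exists>a b. c ` incident_edges E v = {a..b}) \<and> (\<forall>i. card {e \<in> incident_edges E v. c e = i} \<le> 2)"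
        if v: "v \<in> W" and W: "k_improper_interval_coloring 2 W F c'" "incident_edges E v = incident_edges F v"
          "\<forall>e\<in>incident_edges E v. c e = c' e" for v W F c'
      proof -
        have "c ` incident_edges E v = c' ` incident_edges F v"
          using W(2,3) by (auto simp: image_iff)
        moreover have "{e \<in> incident_edges E v. c e = i} = {e \<in> incident_edges F v. c' e = i}" for i
          using W(2,3) by auto
        ultimately show ?thesis
          using W(1) v unfolding k_improper_interval_coloring_def improper_interval_coloring_def by simp
      qed
      have "(\<exists>a b. c ` incident_edges E v = {a..b}) \<and> (\<forall>i. card {e \<in> incident_edges E v. c e = i} \<le> 2)"
        if "v \<in> V" for v
        using good[OF _ c1 1] good[OF _ c2 2] that by (cases "v \<in> K") auto
      hence "k_improper_interval_coloring 2 V E c"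
        unfolding k_improper_interval_coloring_def improper_interval_coloring_def by blast
      thus ?thesis by blast
    qed
  qed
qed

section \<open>Outerplanar graphs\<close>

lemma outerplanar_two_improper:
  assumes "simple_graph V E" "outerplanar V E"
  shows "\<exists>c. k_improper_interval_coloring 2 V E c"
proof -
  obtain p \<gamma> where "plane_embedding V E p \<gamma>" "p ` V \<subseteq> frontier (outside (drawing V E p \<gamma>))"
    using assms(2) unfolding outerplanar_def by (elim exE conjE)
  then interpret outerplane V E p \<gamma> using assms(1) by unfold_locales
  obtain pos where "one_page V E pos"
    using one_page_exists[OF assms(1) theta_free_edges crossing_free_edges] by (elim exE)
  thus ?thesis by (rule one_page_two_improper[OF assms(1)])
qed

theorem theorem20:
  fixes V :: "'a set" and E :: "'a set set"
  assumes "simple_graph V E"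
    and "outerplanar V E"
    and "max_degree V E \<ge> 6"
  shows "int (mu_int V E) \<le> \<lceil>real (max_degree V E) / 5\<rceil>"
proof -
  have "mu_int V E \<le> 2"
    unfolding mu_int_def using outerplanar_two_improper[OF assms(1,2)] by (intro Least_le) simp
  moreover have "2 \<le> \<lceil>real (max_degree V E) / 5\<rceil>"
    using assms(3) by (simp add: le_ceiling_iff)
  ultimately show ?thesis by linarith
qed

end
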